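(* Let $n\geq 4$. Let $\mathcal{A}_{n-1}=(S_{n-1}\cup\{\otimes\},A_{n-1},\mu_{n-1},i)$ be an automaton over $A_{n-1}$, and let $P_n=(S_n^\ast\cup\{\otimes\},A_n,\mu_n^\ast,I_n)$ be the partial automaton constructed in the context from a given partial automaton recognizing $\Pi(R_{n-1}^\ast)$. Define the automaton $\mathcal{A}_n=(S_n\cup\{\otimes\},A_n,\mu_n,i)$ by $S_n=S_{n-1}\sqcup S_n^\ast$ and $$\mu_n(s,x)=\begin{cases}\mu_{n-1}(s,x)&\text{if } s\in S_{n-1}\text{ and }x\in A_{n-1},\\ I_n(x)&\text{if } s\in S_{n-1}\text{ and }x\in A_n\setminus A_{n-1},\\ \mu_n^\ast(s,x)&\text{if } s\in S_n^\ast.\end{cases}$$ If $\mathcal{A}_{n-1}$ recognizes $\Pi(R_{n-1})$, then $\mathcal{A}_n$ recognizes $\Pi(R_n)$.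
   Context: For $n\geq 2$ let $A_n=\{a_{p,q}\mid 1\leq p<q\leq n\}$. The dual braid monoid $B_n^{+*}$ is the monoid presented by generators $A_n$ and relations: $a_{p,q}a_{r,s}=a_{r,s}a_{p,q}$ whenever $[p,q]$ and $[r,s]$ are disjoint or nested (nested means $r<p<q<s$ or $p<r<s<q$), and $a_{p,q}a_{q,r}=a_{q,r}a_{p,r}=a_{p,r}a_{p,q}$ for $1\leq p<q<r\leq n$. Its elements are called braids; $B_{n-1}^{+*}$ is identified with the submonoid of $B_n^{+*}$ generated by $A_{n-1}$. An $A_n$-word is a word on $A_n$; $\varepsilon$ is the empty word. The automorphism $\phi_n$ of $B_n^{+*}$ is given by $\phi_n(a_{p,q})=a_{p+1,q+1}$ for $q\leq n-1$ and $\phi_n(a_{p,n})=a_{1,p+1}$; it is applied letterwise to words, and $\phi_n^n=\mathrm{id}$. A braid $\gamma$ is a right-divisor of $\beta$ if $\beta=\beta'\gamma$ for some $\beta'\in B_n^{+*}$. For $n\geq 3$, the $B_{n-1}^{+*}$-tail of $\beta\in B_n^{+*}$ is the maximal right-divisor of $\beta$ lying in $B_{n-1}^{+*}$. For $n\geq3$ and $\beta\in B_n^{+*}$ nontrivial there is (known) a unique sequence $(\beta_b,\ldots,\beta_1)$ in $B_{n-1}^{+*}$, the $\phi_n$-splitting of $\beta$, with $\beta_b\neq 1$, $\beta=\phi_n^{b-1}(\beta_b)\cdots\phi_n(\beta_2)\,\beta_1$, and such that for $1\le k<b$ the $B_{n-1}^{+*}$-tail of $\phi_n^{b-k}(\beta_b)\cdots\phi_n(\beta_{k+1})$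 is trivial. Rotating normal form: $r_2(\beta)$ is the unique word $a_{1,2}^k$ representing $\beta\in B_2^{+*}$; for $n\geq3$, $r_n(1)=\varepsilon$ and for nontrivial $\beta$ with splitting $(\beta_b,\ldots,\beta_1)$, $r_n(\beta)=\phi_n^{b-1}(r_{n-1}(\beta_b))\cdots\phi_n(r_{n-1}(\beta_2))\cdot r_{n-1}(\beta_1)$. $R_n$ is the set of $n$-rotating words, i.e. words $r_n(\beta)$, $\beta\in B_n^{+*}$. $R_n^\ast$ is the set of $n$-rotating words that are empty or end with a letter $a_{p,n}$ for some $p$. For a word $w=x_0\cdots x_k$, $\Pi(w)=x_k\cdots x_0$ is the reversed word, and $\Pi(L)=\{\Pi(w)\mid w\in L\}$. Automata: an automaton $(S\cup\{\otimes\},A,\mu,i)$ has finite state set $S\cup\{\otimes\}$, alphabet $A$, transition function $\mu$, initial state $i\in S$; $\otimes$ is an absorbing dead state and all other states are accepting. It recognizes the set of words which, read from left to right starting at $i$, do not lead to $\otimes$. A partial automaton is $P=(S\cup\{\otimes\},A,\mu,I)$ with $S,A,\mu$ as for an automaton and $I:A\to S\cup\{\otimes\}$ a map. Its closure is the automaton obtained by adding a new (accepting) initial state $\circ$ with $\mu^c(\circ,x)=I(x)$ and $\mu^c(s,x)=\mu(s,x)$ for the other states $s$. A partial automaton recognizes a language if its closure does. Construction of $P_n$ ($n\geq4$): let $P_{n-1}=(T\cup\{\otimes\},A_{n-1},\mu',I')$ be a given partial automaton recognizing $\Pi(R_{n-1}^\ast)$. For $x=a_{i,j}\in A_{n-1}$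 let $\mathrm{bar}(x)=\{a_{p,n}\mid i<p<j\}$. For $k\in\{0,\ldots,n-1\}$ let $S_n^k=\{k\}\times T\times\mathcal{P}(\{a_{2,n},\ldots,a_{n-2,n}\})$, where $\mathcal{P}$ denotes the power set. Define $I_n^k:\phi_n^k(A_{n-1})\to S_n^k\cup\{\otimes\}$ and $\mu_n^k$ on $S_n^k\times\phi_n^k(A_{n-1})$ by: for $x\in A_{n-1}$, $I_n^k(\phi_n^k(x))=(k,I'(x),\mathrm{bar}(x))$ if $I'(x)\ne\otimes$ and $\otimes$ otherwise; $\mu_n^k((k,s,m),\phi_n^k(x))=(k,\mu'(s,x),m\cup\mathrm{bar}(x))$ if $\mu'(s,x)\neq\otimes$ and $\otimes$ otherwise. Put $I_n^n=I_n^0$. Then $P_n=(S_n^\ast\cup\{\otimes\},A_n,\mu_n^\ast,I_n)$ where $S_n^\ast=S_n^0\sqcup\cdots\sqcup S_n^{n-1}$; $I_n(a_{p,n})=I_n^1(\phi_n(a_{p-1,n-1}))=I_n^1(a_{p,n})$ for $2\le p\le n-1$, $I_n(a_{1,n})=I_n^2(\phi_n^2(a_{n-2,n-1}))=I_n^2(a_{1,n})$, and $I_n(x)=\otimes$ for all other letters $x$; and $\mu_n^\ast((k,s,m),\phi_n^k(x))$ equals $\mu_n^k((k,s,m),\phi_n^k(x))$ if $x\in A_{n-1}$; equals $I_n^{k+1}(\phi_n^k(x))$ if $x=a_{n-1,n}$; equals $I_n^{k+1}(\phi_n^k(x))$ if $x=a_{p,n}$ with $2\le p\le n-2$ and $a_{p,n}\in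 m$; and equals $\otimes$ otherwise. *)

theory Defs
  imports "HOL-Algebra.Group"
begin

text \<open>The letter \<open>a\<^bsub>p,q\<^esub>\<close> is the pair \<open>(p, q)\<close>.\<close>

type_synonym letter = "nat \<times> nat"
type_synonym braid_word = "letter list"

definition gens :: "nat \<Rightarrow> letter set" where
  "gens n = {(p, q). 1 \<le> p \<and> p < q \<and> q \<le> n}"


section \<open>Dual braid monoids\<close>

inductive dual_eq :: "nat \<Rightarrow> braid_word \<Rightarrow> braid_word \<Rightarrow> bool" for n :: nat where
  refl: "u \<in> lists (gens n) \<Longrightarrow> dual_eq n u u"
| sym: "dual_eq n u v \<Longrightarrow> dual_eq n v u"
| trans: "dual_eq n u v \<Longrightarrow> dual_eq n v w \<Longrightarrow> dual_eq n u w"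
| cong: "dual_eq n u v \<Longrightarrow> s \<in> lists (gens n) \<Longrightarrow> t \<in> lists (gens n)
          \<Longrightarrow> dual_eq n (s @ u @ t) (s @ v @ t)"
| comm: "(p, q) \<in> gens n \<Longrightarrow> (r, s) \<in> gens n
          \<Longrightarrow> {p..q} \<inter> {r..s} = {} \<or> (r < p \<and> q < s) \<or> (p < r \<and> s < q)
          \<Longrightarrow> dual_eq n [(p, q), (r, s)] [(r, s), (p, q)]"
| triangle1: "1 \<le> p \<Longrightarrow> p < q \<Longrightarrow> q < r \<Longrightarrow> r \<le> n
          \<Longrightarrow> dual_eq n [(p, q), (q, r)] [(q, r), (p, r)]"
| triangle2: "1 \<le> p \<Longrightarrow> p < q \<Longrightarrow> q < r \<Longrightarrow> r \<le> n
          \<Longrightarrow> dual_eq n [(q, r), (p, r)] [(p, r), (p, q)]"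

definition dual_rel :: "nat \<Rightarrow> (braid_word \<times> braid_word) set" where
  "dual_rel n = {(u, v). dual_eq n u v}"

text \<open>A braid is an equivalence class of words.\<close>

type_synonym braid = "braid_word set"

definition dual_braid_monoid :: "nat \<Rightarrow> braid monoid" where
  "dual_braid_monoid n =
    \<lparr>carrier = lists (gens n) // dual_rel n,
     mult = (\<lambda>X Y. dual_rel n `` {u @ v | u v. u \<in> X \<and> v \<in> Y}),
     one = dual_rel n `` {[]}\<rparr>"

text \<open>The identification of \<open>B\<^bsub>n-1\<^esub>\<close> with the submonoid of \<open>B\<^bsub>n\<^esub>\<close> generated by the
  letters of \<open>gens (n - 1)\<close>: the class of a word modulo the relations for \<open>n - 1\<close> is sent
  to its class modulo the relations for \<open>n\<close>. Both sides of each defining relation use the same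
  indices, so this map is injective.\<close>

definition embed :: "nat \<Rightarrow> braid \<Rightarrow> braid" where
  "embed n \<beta> = dual_rel n `` \<beta>"

definition lower_submonoid :: "nat \<Rightarrow> braid set" where
  "lower_submonoid n = embed n ` carrier (dual_braid_monoid (n - 1))"

fun phi :: "nat \<Rightarrow> letter \<Rightarrow> letter" where
  "phi n (p, q) = (if q < n then (p + 1, q + 1) else (1, p + 1))"

definition phi_word :: "nat \<Rightarrow> braid_word \<Rightarrow> braid_word" where
  "phi_word n = map (phi n)"

definition phi_braid :: "nat \<Rightarrow> braid \<Rightarrow> braid" where
  "phi_braid n \<beta> = dual_rel n `` (phi_word n ` \<beta>)"

definition right_divisor :: "nat \<Rightarrow> braid \<Rightarrow> braid \<Rightarrow> bool" where
  "right_divisor n \<gamma> \<beta> \<longleftrightarrow>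
    (\<exists>\<beta>' \<in> carrier (dual_braid_monoid n). \<beta> = \<beta>' \<otimes>\<^bsub>dual_braid_monoid n\<^esub> \<gamma>)"

definition is_tail :: "nat \<Rightarrow> braid \<Rightarrow> braid \<Rightarrow> bool" where
  "is_tail n \<beta> \<gamma> \<longleftrightarrow>
    \<gamma> \<in> lower_submonoid n \<and> right_divisor n \<gamma> \<beta> \<and>
    (\<forall>\<delta> \<in> lower_submonoid n. right_divisor n \<delta> \<beta> \<longrightarrow> right_divisor n \<delta> \<gamma>)"


section \<open>Splitting and rotating normal form\<close>

text \<open>A sequence \<open>(\<beta>\<^bsub>b\<^esub>, \<dots>, \<beta>\<^bsub>1\<^esub>)\<close> is the list \<open>[\<beta>\<^bsub>b\<^esub>, \<dots>, \<beta>\<^bsub>1\<^esub>]\<close>.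
  For \<open>[x\<^bsub>m\<^esub>, \<dots>, x\<^bsub>1\<^esub>]\<close>, the value of \<open>rot_prod n e\<close> is the product of the
  \<open>(phi_braid n ^^ (e + j - 1)) x\<^bsub>j\<^esub>\<close> for \<open>j = m, \<dots>, 1\<close>.\<close>

fun rot_prod :: "nat \<Rightarrow> nat \<Rightarrow> braid list \<Rightarrow> braid" where
  "rot_prod n e [] = \<one>\<^bsub>dual_braid_monoid n\<^esub>"
| "rot_prod n e (x # xs) =
    (phi_braid n ^^ (e + length xs)) (embed n x) \<otimes>\<^bsub>dual_braid_monoid n\<^esub> rot_prod n e xs"

fun rot_word :: "nat \<Rightarrow> braid_word list \<Rightarrow> braid_word" where
  "rot_word n [] = []"
| "rot_word n (w # ws) = (phi_word n ^^ length ws) w @ rot_word n ws"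

text \<open>\<open>take (b - k) bs\<close> is \<open>[\<beta>\<^bsub>b\<^esub>, \<dots>, \<beta>\<^bsub>k+1\<^esub>]\<close>.\<close>

definition is_splitting :: "nat \<Rightarrow> braid \<Rightarrow> braid list \<Rightarrow> bool" where
  "is_splitting n \<beta> bs \<longleftrightarrow>
    bs \<noteq> [] \<and> set bs \<subseteq> carrier (dual_braid_monoid (n - 1)) \<and>
    hd bs \<noteq> \<one>\<^bsub>dual_braid_monoid (n - 1)\<^esub> \<and>
    \<beta> = rot_prod n 0 bs \<and>
    (\<forall>k. 1 \<le> k \<and> k < length bs \<longrightarrow>
      is_tail n (rot_prod n 1 (take (length bs - k) bs)) \<one>\<^bsub>dual_braid_monoid n\<^esub>)"

text \<open>\<open>rotating_nf n \<beta> w\<close> is the graph of the normal form, \<open>w = r\<^bsub>n\<^esub>(\<beta>)\<close>; it is a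
  function because a nontrivial braid has exactly one splitting.\<close>

inductive rotating_nf :: "nat \<Rightarrow> braid \<Rightarrow> braid_word \<Rightarrow> bool" where
  two: "\<beta> \<in> carrier (dual_braid_monoid 2) \<Longrightarrow> replicate k (1, 2) \<in> \<beta>
    \<Longrightarrow> rotating_nf 2 \<beta> (replicate k (1, 2))"
| trivial: "n \<ge> 3 \<Longrightarrow> rotating_nf n \<one>\<^bsub>dual_braid_monoid n\<^esub> []"
| split: "n \<ge> 3 \<Longrightarrow> \<beta> \<in> carrier (dual_braid_monoid n) \<Longrightarrow> \<beta> \<noteq> \<one>\<^bsub>dual_braid_monoid n\<^esub>
    \<Longrightarrow> is_splitting n \<beta> bs \<Longrightarrow> list_all2 (rotating_nf (n - 1)) bs ws
    \<Longrightarrow> rotating_nf n \<beta> (rot_word n ws)"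

definition rotating_words :: "nat \<Rightarrow> braid_word set" where
  "rotating_words n = {w. \<exists>\<beta> \<in> carrier (dual_braid_monoid n). rotating_nf n \<beta> w}"

definition rotating_words_star :: "nat \<Rightarrow> braid_word set" where
  "rotating_words_star n = {w \<in> rotating_words n. w = [] \<or> (\<exists>p. last w = (p, n))}"

definition mirror :: "'x list set \<Rightarrow> 'x list set" where
  "mirror L = rev ` L"


section \<open>Automata\<close>

text \<open>The dead state is \<open>None\<close>, and is left implicit in the set of states; the transition
  function is only meaningful on states and letters of the alphabet.\<close>

record ('s, 'x) automaton =
  states :: "'s set"
  alphabet :: "'x set"
  trans :: "'s \<Rightarrow> 'x \<Rightarrow> 's option"
  init :: 's

definition is_automaton :: "('s, 'x) automaton \<Rightarrow> bool" where
  "is_automaton M \<longleftrightarrow>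
    finite (states M) \<and> init M \<in> states M \<and>
    (\<forall>s \<in> states M. \<forall>x \<in> alphabet M. trans M s x \<in> Some ` states M \<union> {None})"

fun run :: "('s \<Rightarrow> 'x \<Rightarrow> 's option) \<Rightarrow> 's option \<Rightarrow> 'x list \<Rightarrow> 's option" where
  "run \<mu> s [] = s"
| "run \<mu> s (x # w) = run \<mu> (case s of None \<Rightarrow> None | Some t \<Rightarrow> \<mu> t x) w"

definition recognizes :: "('s, 'x) automaton \<Rightarrow> 'x list set \<Rightarrow> bool" where
  "recognizes M L \<longleftrightarrow>
    L = {w \<in> lists (alphabet M). run (trans M) (Some (init M)) w \<noteq> None}"

record ('s, 'x) partial_automaton =
  pstates :: "'s set"
  palphabet :: "'x set"
  ptrans :: "'s \<Rightarrow> 'x \<Rightarrow> 's option"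
  pinit :: "'x \<Rightarrow> 's option"

definition is_partial_automaton :: "('s, 'x) partial_automaton \<Rightarrow> bool" where
  "is_partial_automaton P \<longleftrightarrow>
    finite (pstates P) \<and>
    (\<forall>x \<in> palphabet P. pinit P x \<in> Some ` pstates P \<union> {None}) \<and>
    (\<forall>s \<in> pstates P. \<forall>x \<in> palphabet P. ptrans P s x \<in> Some ` pstates P \<union> {None})"

datatype 's closure_state = Start | Old 's

definition closure :: "('s, 'x) partial_automaton \<Rightarrow> ('s closure_state, 'x) automaton" where
  "closure P =
    \<lparr>states = insert Start (Old ` pstates P),
     alphabet = palphabet P,
     trans = (\<lambda>s x. case s of
        Start \<Rightarrow> map_option Old (pinit P x)
      | Old t \<Rightarrow> map_option Old (ptrans P t x)),
     init = Start\<rparr>"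

definition partial_recognizes :: "('s, 'x) partial_automaton \<Rightarrow> 'x list set \<Rightarrow> bool" where
  "partial_recognizes P L \<longleftrightarrow> recognizes (closure P) L"


section \<open>From a partial automaton over \<open>gens (n - 1)\<close> to one over \<open>gens n\<close>\<close>

fun bar :: "nat \<Rightarrow> letter \<Rightarrow> letter set" where
  "bar n (i, j) = {(p, n) | p. i < p \<and> p < j}"

type_synonym 't next_state = "nat \<times> 't \<times> letter set"

definition next_states :: "nat \<Rightarrow> ('t, letter) partial_automaton \<Rightarrow> nat \<Rightarrow> 't next_state set" where
  "next_states n P k = {k} \<times> pstates P \<times> Pow {(p, n) | p. 2 \<le> p \<and> p \<le> n - 2}"

text \<open>The unique letter \<open>x\<close> of \<open>gens n\<close> with \<open>(phi n ^^ k) x = y\<close>, for \<open>y\<close> in \<open>gens n\<close>.\<close>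

definition unrotate :: "nat \<Rightarrow> nat \<Rightarrow> letter \<Rightarrow> letter" where
  "unrotate n k y = inv_into (gens n) (phi n ^^ k) y"

text \<open>The maps \<open>I\<^bsub>n\<^esub>\<^bsup>k\<^esup>\<close> for \<open>k \<le> n\<close>, with \<open>I\<^bsub>n\<^esub>\<^bsup>n\<^esup> = I\<^bsub>n\<^esub>\<^bsup>0\<^esup>\<close>, and \<open>\<mu>\<^bsub>n\<^esub>\<^bsup>k\<^esup>\<close> for \<open>k < n\<close>.\<close>

definition level_init ::
    "nat \<Rightarrow> ('t, letter) partial_automaton \<Rightarrow> nat \<Rightarrow> letter \<Rightarrow> 't next_state option" where
  "level_init n P k y =
    (let k' = (if k = n then 0 else k); x = unrotate n k' y
     in map_option (\<lambda>t. (k', t, bar n x)) (pinit P x))"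

definition level_trans ::
    "nat \<Rightarrow> ('t, letter) partial_automaton \<Rightarrow> nat \<Rightarrow> 't next_state \<Rightarrow> letter \<Rightarrow> 't next_state option"
  where
  "level_trans n P k st y =
    (case st of (_, s, m) \<Rightarrow>
      let x = unrotate n k y
      in map_option (\<lambda>t. (k, t, m \<union> bar n x)) (ptrans P s x))"

definition next_init ::
    "nat \<Rightarrow> ('t, letter) partial_automaton \<Rightarrow> letter \<Rightarrow> 't next_state option" where
  "next_init n P y =
    (case y of (p, q) \<Rightarrow>
      if q = n \<and> 2 \<le> p \<and> p \<le> n - 1 then level_init n P 1 y
      else if q = n \<and> p = 1 then level_init n P 2 y
      else None)"

definition next_trans ::
    "nat \<Rightarrow> ('t, letter) partial_automaton \<Rightarrow> 't next_state \<Rightarrow> letter \<Rightarrow> 't next_state option" where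
  "next_trans n P st y =
    (case st of (k, s, m) \<Rightarrow>
      let x = unrotate n k y
      in if x \<in> gens (n - 1) then level_trans n P k (k, s, m) y
         else if x = (n - 1, n) then level_init n P (k + 1) y
         else if (\<exists>p. 2 \<le> p \<and> p \<le> n - 2 \<and> x = (p, n)) \<and> x \<in> m then level_init n P (k + 1) y
         else None)"

definition next_partial ::
    "nat \<Rightarrow> ('t, letter) partial_automaton \<Rightarrow> ('t next_state, letter) partial_automaton" where
  "next_partial n P =
    \<lparr>pstates = (\<Union>k \<in> {0..<n}. next_states n P k),
     palphabet = gens n,
     ptrans = next_trans n P,
     pinit = next_init n P\<rparr>"

definition extend_automaton ::
    "nat \<Rightarrow> ('s, letter) automaton \<Rightarrow> ('u, letter) partial_automaton \<Rightarrow> ('s + 'u, letter) automaton"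
  where
  "extend_automaton n M Q =
    \<lparr>states = states M <+> pstates Q,
     alphabet = gens n,
     trans = (\<lambda>s x. case s of
        Inl t \<Rightarrow> if x \<in> gens (n - 1) then map_option Inl (trans M t x)
                 else map_option Inr (pinit Q x)
      | Inr u \<Rightarrow> map_option Inr (ptrans Q u x)),
     init = Inl (init M)\<rparr>"

end

theory Submission imports Defs begin

text \<open>Every word \<open>w\<close> determines an equivalence relation \<open>alpha w\<close> on points, the noncrossing partition
  of the greatest simple right-divisor of its braid; appending a letter \<open>a\<^bsub>p,q\<^esub>\<close> cuts all blocks along
  the arcs \<open>{p+1..q}\<close> and its complement and then merges the blocks of \<open>p\<close> and \<open>q\<close>. A letter right-divides
  the braid iff its two points are equivalent. So the tail conditions of a splitting become
  statements about \<open>alpha\<close>: each partial product must have exactly one nontrivial pair, and this pair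
  contains \<open>n\<close> after rotation. If the earlier blocks leave the single pair \<open>{s, n}\<close>, then appending a block
  ending with \<open>a\<^bsub>t,n-1\<^esub>\<close> leaves a single pair iff \<open>s = n - 1\<close> or the block has a letter \<open>a\<^bsub>p,q\<^esub>\<close> with
  \<open>p < s < q\<close>. These are the conditions that the automaton checks while it reads the blocks from
  right to left, the sets \<open>bar\<close> recording the available values of \<open>s\<close>.\<close>

section \<open>Words and braids\<close>

text \<open>Two facts tie \<open>alpha\<close> to braids: it is invariant under the defining
  relations, and related points correspond to right-dividing letters. Letters suffice to test a
  trivial tail, because a nonempty word over \<open>gens (n - 1)\<close> that divides has a last
  letter, which divides too. That a block ending with \<open>(t, n - 1)\<close> has by itself only
  the pair \<open>{t, n - 1}\<close> is the tail condition one level down, applied to the block as a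
  rotating word; hence the partial automaton for \<open>rotating_words_star\<close>. Block
  boundaries are visible to a deterministic reader. In the coordinates of the current block its
  letters lie in \<open>gens (n - 1)\<close>, while the next block, read from its right end, starts
  with \<open>phi n (t, n - 1) = (t + 1, n)\<close>. So \<open>s = t + 1\<close> is read off the
  very letter that changes the block, and it is compared with the \<open>bar\<close> sets at that
  moment. The block read first is bound by no tail condition, since only the product to its left is
  tested; this is why it is left to the automaton for all of
  \<open>rotating_words (n - 1)\<close>.\<close>

lemma dual_eq_lists: "dual_eq n u v \<Longrightarrow> u \<in> lists (gens n) \<and> v \<in> lists (gens n)"
  by (induction rule: dual_eq.induct) (auto simp: gens_def)

lemma dual_eq_length: "dual_eq n u v \<Longrightarrow> length u = length v"
  by (induction rule: dual_eq.induct) auto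

lemma gens_mono: "m \<le> n \<Longrightarrow> gens m \<subseteq> gens n"
  by (auto simp: gens_def)

lemma dual_eq_mono:
  assumes "dual_eq m u v" "m \<le> n"
  shows "dual_eq n u v"
  using assms(1)
proof (induction rule: dual_eq.induct)
  case (refl u)
  then show ?case using gens_mono[OF assms(2)] by (meson dual_eq.refl lists_mono subsetD)
next
  case (cong u v s t)
  then show ?case using gens_mono[OF assms(2)] by (meson dual_eq.cong lists_mono subsetD)
next
  case (comm p q r s)
  then show ?case using gens_mono[OF assms(2)] by (meson dual_eq.comm subsetD)
next
  case (triangle1 p q r)
  then show ?case using assms(2) by (meson dual_eq.triangle1 le_trans)
next
  case (triangle2 p q r)
  then show ?case using assms(2) by (meson dual_eq.triangle2 le_trans)
qed (blast intro: dual_eq.sym dual_eq.trans)+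

lemma dual_eq_comm:
  assumes "(p, q) \<in> gens n" "(r, s) \<in> gens n"
    "q < r \<or> s < p \<or> (r < p \<and> q < s) \<or> (p < r \<and> s < q)"
  shows "dual_eq n [(p, q), (r, s)] [(r, s), (p, q)]"
  using assms by (intro dual_eq.comm) auto

lemma dual_eq_triangles:
  assumes "1 \<le> p" "p < q" "q < r" "r \<le> n"
  shows "dual_eq n [(p, q), (q, r)] [(q, r), (p, r)]"
    "dual_eq n [(q, r), (p, r)] [(p, r), (p, q)]"
    "dual_eq n [(p, r), (p, q)] [(p, q), (q, r)]"
  using dual_eq.triangle1[OF assms] dual_eq.triangle2[OF assms]
  by (blast intro: dual_eq.sym dual_eq.trans)+

lemma phi_gens: "x \<in> gens n \<Longrightarrow> phi n x \<in> gens n"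
  by (cases x) (auto simp: gens_def)

lemma phi_word_lists: "w \<in> lists (gens n) \<Longrightarrow> phi_word n w \<in> lists (gens n)"
  using phi_gens by (auto simp: phi_word_def)

lemma funpow_phi_word_lists: "w \<in> lists (gens n) \<Longrightarrow> (phi_word n ^^ k) w \<in> lists (gens n)"
  by (induction k) (simp_all only: funpow.simps comp_def id_def phi_word_lists)

lemma phi_word_Nil [simp]: "phi_word n [] = []"
  by (simp add: phi_word_def)

lemma phi_word_append [simp]: "phi_word n (u @ v) = phi_word n u @ phi_word n v"
  by (simp add: phi_word_def)

lemma funpow_phi_word_append:
  "(phi_word n ^^ k) (u @ v) = (phi_word n ^^ k) u @ (phi_word n ^^ k) v"
  by (induction k) auto

lemma dual_eq_phi_word: "dual_eq n u v \<Longrightarrow> dual_eq n (phi_word n u) (phi_word n v)"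
proof (induction rule: dual_eq.induct)
  case (refl u)
  then show ?case by (intro dual_eq.refl phi_word_lists)
next
  case (cong u v s t)
  then show ?case by (simp add: dual_eq.cong phi_word_lists)
next
  case (comm p q r s)
  then have "q < r \<or> s < p \<or> (r < p \<and> q < s) \<or> (p < r \<and> s < q)"
    by (auto simp: gens_def)
  with comm phi_gens[OF comm(1)] phi_gens[OF comm(2)] show ?case
    by (auto simp: phi_word_def gens_def split: if_splits intro!: dual_eq_comm)
next
  case (triangle1 p q r)
  then show ?case
    using dual_eq_triangles[of "Suc p" "Suc q" "Suc r" n] dual_eq_triangles[of 1 "Suc p" "Suc q" n]
    by (cases "r < n") (auto simp: phi_word_def)
next
  case (triangle2 p q r)
  then show ?case
    using dual_eq_triangles[of "Suc p" "Suc q" "Suc r" n] dual_eq_triangles[of 1 "Suc p" "Suc q" n]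
    by (cases "r < n") (auto simp: phi_word_def)
qed (blast intro: dual_eq.sym dual_eq.trans)+

definition braid_of :: "nat \<Rightarrow> braid_word \<Rightarrow> braid" where
  "braid_of n w = dual_rel n `` {w}"

lemma equiv_dual_rel: "equiv (lists (gens n)) (dual_rel n)"
  using dual_eq_lists
  by (auto simp: equiv_def refl_on_def sym_def dual_rel_def
      intro: dual_eq.refl dual_eq.sym dual_eq.trans intro!: transI)

lemma braid_of_eq_iff:
  "u \<in> lists (gens n) \<Longrightarrow> v \<in> lists (gens n) \<Longrightarrow> braid_of n u = braid_of n v \<longleftrightarrow> dual_eq n u v"
  using eq_equiv_class_iff[OF equiv_dual_rel, of u n v] by (simp add: braid_of_def dual_rel_def)

lemma carrier_dual_braid_monoid:
  "carrier (dual_braid_monoid n) = braid_of n ` lists (gens n)"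
  by (auto simp: dual_braid_monoid_def quotient_def braid_of_def)

lemma braid_of_in_carrier:
  "w \<in> lists (gens n) \<Longrightarrow> braid_of n w \<in> carrier (dual_braid_monoid n)"
  by (simp add: carrier_dual_braid_monoid)

lemma one_dual_braid_monoid: "\<one>\<^bsub>dual_braid_monoid n\<^esub> = braid_of n []"
  by (simp add: dual_braid_monoid_def braid_of_def)

lemma in_braid_of: "v \<in> braid_of n u \<longleftrightarrow> dual_eq n u v"
  by (simp add: braid_of_def dual_rel_def)

lemma dual_eq_append:
  assumes "dual_eq n u u'" "dual_eq n v v'"
  shows "dual_eq n (u @ v) (u' @ v')"
proof -
  have "dual_eq n (u @ v) (u' @ v)"
    using dual_eq.cong[OF assms(1), of "[]" v] dual_eq_lists[OF assms(2)] by auto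
  moreover have "dual_eq n (u' @ v) (u' @ v')"
    using dual_eq.cong[OF assms(2), of u' "[]"] dual_eq_lists[OF assms(1)] by auto
  ultimately show ?thesis by (rule dual_eq.trans)
qed

lemma mult_braid_of:
  assumes "u \<in> lists (gens n)" "v \<in> lists (gens n)"
  shows "braid_of n u \<otimes>\<^bsub>dual_braid_monoid n\<^esub> braid_of n v = braid_of n (u @ v)"
proof -
  have "dual_eq n (u @ v) y"
    if "dual_eq n u u'" "dual_eq n v v'" "dual_eq n (u' @ v') y" for u' v' y
    using dual_eq_append[OF that(1,2)] that(3) by (rule dual_eq.trans)
  moreover have "dual_eq n u u" "dual_eq n v v"
    using assms by (auto intro: dual_eq.refl)
  ultimately show ?thesis
    by (auto simp: dual_braid_monoid_def braid_of_def dual_rel_def)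
qed

lemma embed_braid_of:
  assumes "w \<in> lists (gens (n - 1))"
  shows "embed n (braid_of (n - 1) w) = braid_of n w"
  using assms dual_eq_mono[of "n - 1" _ _ n] dual_eq.refl[OF assms]
  by (auto simp: embed_def braid_of_def dual_rel_def intro: dual_eq.trans)

lemma phi_braid_braid_of:
  assumes "w \<in> lists (gens n)"
  shows "phi_braid n (braid_of n w) = braid_of n (phi_word n w)"
  using dual_eq.refl[OF assms]
  by (auto simp: phi_braid_def braid_of_def dual_rel_def intro: dual_eq.trans dual_eq_phi_word)

lemma funpow_phi_braid_braid_of:
  assumes "w \<in> lists (gens n)"
  shows "(phi_braid n ^^ k) (braid_of n w) = braid_of n ((phi_word n ^^ k) w)"
  using funpow_phi_word_lists[OF assms]
  by (induction k) (auto simp: phi_braid_braid_of)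

lemma lists_gens_pred: "w \<in> lists (gens (n - 1)) \<Longrightarrow> w \<in> lists (gens n)"
  using gens_mono[of "n - 1" n] by auto

lemma rot_word_lists:
  "ws \<in> lists (lists (gens (n - 1))) \<Longrightarrow> rot_word n ws \<in> lists (gens n)"
proof (induction ws)
  case (Cons w ws)
  then have "w \<in> lists (gens n)" using lists_gens_pred by auto
  then show ?case using Cons funpow_phi_word_lists[of w n] by auto
qed auto

lemma rot_prod_braid_of:
  "ws \<in> lists (lists (gens (n - 1))) \<Longrightarrow>
    rot_prod n e (map (braid_of (n - 1)) ws) = braid_of n ((phi_word n ^^ e) (rot_word n ws))"
proof (induction ws)
  case Nil
  have "(phi_word n ^^ e) [] = []" by (induction e) (auto simp: phi_word_def)
  then show ?case by (simp add: one_dual_braid_monoid)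
next
  case (Cons w ws)
  then have w: "w \<in> lists (gens (n - 1))" "w \<in> lists (gens n)"
    using lists_gens_pred by auto
  have "ws \<in> lists (lists (gens (n - 1)))" using Cons.prems by simp
  then show ?case
    using Cons.IH w(2) funpow_phi_word_lists[of w n] rot_word_lists[of ws n]
      funpow_phi_word_lists[of "rot_word n ws" n]
    by (simp add: embed_braid_of[OF w(1), simplified] funpow_phi_braid_braid_of mult_braid_of
        funpow_phi_word_append funpow_add funpow_phi_word_lists)
qed

section \<open>Right-dividing letters\<close>

type_synonym point_rel = "nat \<Rightarrow> nat \<Rightarrow> bool"

text \<open>The arc is half-open because of the triangle relations: a chord \<open>(p, j)\<close>
  with \<open>q < j\<close> or \<open>(i, q)\<close> with \<open>p < i\<close> still right-divides
  after \<open>(p, q)\<close> is appended. So \<open>p\<close> counts as outside and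
  \<open>q\<close> as inside.\<close>

fun same_arc :: "letter \<Rightarrow> nat \<Rightarrow> nat \<Rightarrow> bool" where
  "same_arc (p, q) i j \<longleftrightarrow> (p < i \<and> i \<le> q \<longleftrightarrow> p < j \<and> j \<le> q)"

fun merge :: "letter \<Rightarrow> point_rel \<Rightarrow> point_rel" where
  "merge (p, q) E i j \<longleftrightarrow> E i j \<or> (E i p \<and> E q j) \<or> (E i q \<and> E p j)"

definition cut :: "letter \<Rightarrow> point_rel \<Rightarrow> point_rel" where
  "cut x E i j \<longleftrightarrow> E i j \<and> same_arc x i j"

definition step :: "point_rel \<Rightarrow> letter \<Rightarrow> point_rel" where
  "step E x = merge x (cut x E)"

definition alpha :: "braid_word \<Rightarrow> point_rel" where
  "alpha w = foldl step (=) w"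

text \<open>Writing an equivalence as equality of classes turns the identities about
  \<open>merge\<close> into pure equality reasoning.\<close>

lemma equivp_kernel:
  assumes "equivp E"
  obtains c :: "nat \<Rightarrow> nat \<Rightarrow> bool" where "\<And>i j. E i j \<longleftrightarrow> c i = c j"
  using that[of E] assms by (metis equivp_def)

lemma equivp_cut:
  assumes "equivp E" shows "equivp (cut x E)"
proof -
  obtain c :: "nat \<Rightarrow> nat \<Rightarrow> bool" where c: "\<And>i j. E i j \<longleftrightarrow> c i = c j" using equivp_kernel[OF assms] by metis
  obtain A where A: "\<And>i j. same_arc x i j \<longleftrightarrow> A i = (A j :: bool)"
    by (cases x) force
  show ?thesis
    by (intro equivpI reflpI sympI transpI) (simp_all add: cut_def c A)
qed

lemma equivp_merge:
  assumes "equivp E" shows "equivp (merge x E)"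
proof -
  obtain p q where x: "x = (p, q)" by (meson surj_pair)
  obtain c :: "nat \<Rightarrow> nat \<Rightarrow> bool" where c: "\<And>i j. E i j \<longleftrightarrow> c i = c j" using equivp_kernel[OF assms] by metis
  show ?thesis
    by (intro equivpI reflpI sympI transpI; simp add: x c; smt (verit))
qed

lemma equivp_step: "equivp E \<Longrightarrow> equivp (step E x)"
  by (simp add: step_def equivp_cut equivp_merge)

lemma equivp_foldl_step: "equivp E \<Longrightarrow> equivp (foldl step E w)"
  by (induction w arbitrary: E) (auto simp: equivp_step)

lemma equivp_alpha: "equivp (alpha w)"
  by (simp add: alpha_def equivp_foldl_step identity_equivp)

lemma merge_commute:
  assumes "equivp E" shows "merge x (merge y E) = merge y (merge x E)"
proof -
  obtain p q r s where xy: "x = (p, q)" "y = (r, s)" by (meson surj_pair)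
  obtain c :: "nat \<Rightarrow> nat \<Rightarrow> bool" where c: "\<And>i j. E i j \<longleftrightarrow> c i = c j" using equivp_kernel[OF assms] by metis
  show ?thesis
    unfolding xy by (intro ext; simp add: c; smt (verit))
qed

lemma merge_triangle:
  assumes "equivp E"
  shows "merge (p, q) (merge (q, r) E) = merge (p, r) (merge (q, r) E)"
    "merge (p, r) (merge (q, r) E) = merge (p, q) (merge (p, r) E)"
proof -
  obtain c :: "nat \<Rightarrow> nat \<Rightarrow> bool" where c: "\<And>i j. E i j \<longleftrightarrow> c i = c j" using equivp_kernel[OF assms] by metis
  show "merge (p, q) (merge (q, r) E) = merge (p, r) (merge (q, r) E)"
    by (intro ext; simp add: c; smt (verit))
  show "merge (p, r) (merge (q, r) E) = merge (p, q) (merge (p, r) E)"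
    by (intro ext; simp add: c; smt (verit))
qed

text \<open>A pair created by the merge passes through both endpoints of \<open>x\<close>, and these
  lie in one arc of \<open>y\<close>. The last hypothesis excludes that the cut tears both halves of
  such a pair apart while leaving its two ends in one arc; then cutting the halves is the same as
  cutting the pair.\<close>

lemma cut_merge:
  assumes "equivp E" "same_arc y (fst x) (snd x)"
    "\<And>i j. cut x E i (fst x) \<Longrightarrow> cut x E (snd x) j \<Longrightarrow> same_arc y i j \<Longrightarrow> same_arc y i (fst x)"
  shows "cut y (merge x (cut x E)) = merge x (cut y (cut x E))"
proof -
  obtain p q where x: "x = (p, q)" by (meson surj_pair)
  obtain A where y: "\<And>i j. same_arc y i j \<longleftrightarrow> A i = (A j :: bool)"
    by (cases y) force
  define F where "F = cut x E"
  have s: "F i j \<Longrightarrow> F j i" for i j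
    unfolding F_def by (rule equivp_symp[OF equivp_cut[OF assms(1)]])
  have pq: "A p = A q"
    using assms(2) by (simp add: x y)
  have a: "F i p \<Longrightarrow> F q j \<Longrightarrow> A i = A j \<Longrightarrow> A i = A p" for i j
    using assms(3) by (simp add: x y F_def)
  show ?thesis
    unfolding F_def[symmetric] unfolding x
  proof (intro ext)
    fix i j
    show "cut y (merge (p, q) F) i j = merge (p, q) (cut y F) i j"
      using a[of i j] a[of j i] s[of i q] s[of p j] pq by (auto simp: cut_def y)
  qed
qed

text \<open>By \<open>cut_merge\<close> either order is two merges applied to the doubly cut
  relation, and merges commute.\<close>

lemma step_step_comm:
  assumes E: "equivp E" and "p < q" "r < s"
    "q < r \<or> s < p \<or> (r < p \<and> q < s) \<or> (p < r \<and> s < q)"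
  shows "step (step E (p, q)) (r, s) = step (step E (r, s)) (p, q)"
proof -
  have "cut (r, s) (merge (p, q) (cut (p, q) E)) = merge (p, q) (cut (r, s) (cut (p, q) E))"
    using assms by (intro cut_merge) (auto simp: cut_def)
  moreover have "cut (p, q) (merge (r, s) (cut (r, s) E)) = merge (r, s) (cut (p, q) (cut (r, s) E))"
    using assms by (intro cut_merge) (auto simp: cut_def)
  moreover have "cut (p, q) (cut (r, s) E) = cut (r, s) (cut (p, q) E)"
    by (intro ext) (auto simp: cut_def)
  ultimately show ?thesis
    by (simp only: step_def merge_commute[OF equivp_cut[OF equivp_cut[OF E]], of "(r, s)" "(p, q)"])
qed

text \<open>Each of the three products cuts the circle into the same three arcs and then joins the
  classes of \<open>p\<close>, \<open>q\<close> and \<open>r\<close> into one.\<close>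

lemma step_step_triangle:
  assumes E: "equivp E" and "p < q" "q < r"
  shows "step (step E (p, q)) (q, r) = step (step E (q, r)) (p, r)"
    "step (step E (q, r)) (p, r) = step (step E (p, r)) (p, q)"
proof -
  let ?E = "cut (q, r) (cut (p, q) E)"
  have "cut (q, r) (merge (p, q) (cut (p, q) E)) = merge (p, q) ?E"
    using assms by (intro cut_merge) (auto simp: cut_def)
  moreover have "cut (p, r) (merge (q, r) (cut (q, r) E)) = merge (q, r) (cut (p, r) (cut (q, r) E))"
    using assms by (intro cut_merge) (auto simp: cut_def)
  moreover have "cut (p, q) (merge (p, r) (cut (p, r) E)) = merge (p, r) (cut (p, q) (cut (p, r) E))"
    using assms by (intro cut_merge) (auto simp: cut_def)
  moreover have "cut (p, r) (cut (q, r) E) = ?E" "cut (p, q) (cut (p, r) E) = ?E"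
    using assms by (intro ext; auto simp: cut_def)+
  moreover have E': "equivp ?E" by (simp add: equivp_cut E)
  moreover have "merge (q, r) (merge (p, q) ?E) = merge (p, r) (merge (q, r) ?E)"
    using merge_triangle(1)[OF E', of p q r] merge_commute[OF E', of "(q, r)" "(p, q)"] by simp
  moreover note merge_triangle(2)[OF E', of p r q]
  ultimately show "step (step E (p, q)) (q, r) = step (step E (q, r)) (p, r)"
    "step (step E (q, r)) (p, r) = step (step E (p, r)) (p, q)"
    by (simp_all only: step_def)
qed

text \<open>The start relation is arbitrary because a congruence step puts a prefix in front of the
  relation being applied.\<close>

lemma foldl_step_dual_eq:
  "dual_eq n u v \<Longrightarrow> equivp E \<Longrightarrow> foldl step E u = foldl step E v"
proof (induction arbitrary: E rule: dual_eq.induct)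
  case (cong u v s t)
  then show ?case by (simp add: equivp_foldl_step)
next
  case (comm p q r s)
  then have "q < r \<or> s < p \<or> (r < p \<and> q < s) \<or> (p < r \<and> s < q)"
    by (auto simp: gens_def)
  with comm show ?case
    using step_step_comm[OF comm.prems, of p q r s] by (simp add: gens_def)
next
  case (triangle1 p q r)
  then show ?case using step_step_triangle(1)[OF triangle1.prems, of p q r] by simp
next
  case (triangle2 p q r)
  then show ?case using step_step_triangle(2)[OF triangle2.prems, of p q r] by simp
qed auto

lemma alpha_dual_eq: "dual_eq n u v \<Longrightarrow> alpha u = alpha v"
  by (simp add: alpha_def foldl_step_dual_eq identity_equivp)

lemma alpha_snoc: "alpha (w @ [x]) = step (alpha w) x"
  by (simp add: alpha_def)

lemma alpha_last: "alpha (w @ [(p, q)]) p q"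
  by (simp add: alpha_snoc step_def cut_def equivp_reflp[OF equivp_alpha])

section \<open>Letters as right divisors, compared with the relation \<open>alpha\<close>\<close>

definition letter_divides :: "nat \<Rightarrow> letter \<Rightarrow> braid_word \<Rightarrow> bool" where
  "letter_divides n x w \<longleftrightarrow> (\<exists>u. dual_eq n w (u @ [x]))"

definition chord :: "nat \<Rightarrow> nat \<Rightarrow> letter" where
  "chord i j = (min i j, max i j)"

lemma alpha_points:
  "w \<in> lists (gens n) \<Longrightarrow> alpha w i j \<Longrightarrow> i \<noteq> j \<Longrightarrow> {i, j} \<subseteq> {1..n}"
proof (induction w arbitrary: i j rule: rev_induct)
  case (snoc x w)
  obtain p q where x: "x = (p, q)" by (meson surj_pair)
  have pq: "{p, q} \<subseteq> {1..n}" using snoc.prems(1) by (auto simp: x gens_def)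
  have IH: "alpha w k l \<Longrightarrow> k = l \<or> {k, l} \<subseteq> {1..n}" for k l
    using snoc by auto
  show ?case
    using snoc.prems(2,3) IH[of i j] IH[of i p] IH[of q j] IH[of i q] IH[of p j] pq
    by (auto simp: alpha_snoc x step_def cut_def)
qed (auto simp: alpha_def)

lemma chord_gens: "i \<noteq> j \<Longrightarrow> {i, j} \<subseteq> {1..n} \<Longrightarrow> chord i j \<in> gens n"
  by (auto simp: chord_def gens_def)

text \<open>A chord inside one arc of the letter either shares an endpoint with it, and a triangle
  relation moves it to the right end, or is disjoint from it or nested, and commutes.\<close>

lemma chord_past_letter:
  assumes "(i, j) \<in> gens n" "(p, q) \<in> gens n" "same_arc (p, q) i j"
  shows "\<exists>z. dual_eq n [(i, j), (p, q)] [z, (i, j)]"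
proof -
  have *: "1 \<le> i" "i < j" "j \<le> n" "1 \<le> p" "p < q" "q \<le> n"
    using assms by (auto simp: gens_def)
  consider "i = p" "q < j" | "j = p" | "j = q" "p < i"
    | "j < p \<or> q < i \<or> (p < i \<and> j < q) \<or> (i < p \<and> q < j)"
    using assms(3) * by fastforce
  then show ?thesis
  proof cases
    case 1
    then show ?thesis using dual_eq_triangles[of p q j n] * by (blast intro: dual_eq.trans)
  next
    case 2
    then show ?thesis using dual_eq_triangles[of i p q n] * by (blast intro: dual_eq.trans)
  next
    case 3
    then show ?thesis using dual_eq_triangles[of p i q n] * by (blast intro: dual_eq.trans)
  next
    case 4
    then show ?thesis using dual_eq_comm[OF assms(1,2)] by blast
  qed
qed

lemma dual_eq_suffix:
  assumes "dual_eq n w (u @ s)" "dual_eq n s t"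
  shows "dual_eq n w (u @ t)"
proof -
  have "u \<in> lists (gens n)" using dual_eq_lists[OF assms(1)] by simp
  then show ?thesis
    using assms dual_eq_append[OF dual_eq.refl assms(2)] by (blast intro: dual_eq.trans)
qed

lemma letter_divides_suffix:
  assumes "dual_eq n w (u @ s)" "dual_eq n s (t @ [x])"
  shows "letter_divides n x w"
  using dual_eq_suffix[OF assms] unfolding letter_divides_def by (metis append_assoc)

text \<open>With \<open>a < p < b < q\<close>, three triangle rewritings of the last letters
  suffice: \<open>(b,q)(a,p)(p,q)\<close>, \<open>(b,q)(a,q)(a,p)\<close>,
  \<open>(a,q)(a,b)(a,p)\<close>, \<open>(a,q)(p,b)(a,b)\<close>.\<close>

lemma letter_divides_merge_above:
  assumes "dual_eq n w (u @ [(b, q), (a, p), (p, q)])" "1 \<le> a" "a < p" "p < b" "b < q" "q \<le> n"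
  shows "letter_divides n (a, b) w"
proof -
  have "dual_eq n [(a, p), (p, q)] [(a, q), (a, p)]"
    using dual_eq_triangles[of a p q n] assms by (auto intro: dual_eq.trans)
  then have "dual_eq n w (u @ [(b, q), (a, q), (a, p)])"
    using dual_eq_suffix[of n w "u @ [(b, q)]"] assms(1) by auto
  moreover have "dual_eq n ([(b, q), (a, q)] @ [(a, p)]) ([(a, q), (a, b)] @ [(a, p)])"
    using dual_eq_triangles(2)[of a b q n] assms
    by (intro dual_eq_append dual_eq.refl) (auto simp: gens_def)
  ultimately have "dual_eq n w (u @ [(a, q), (a, b), (a, p)])"
    using dual_eq_suffix by fastforce
  moreover have "dual_eq n [(a, b), (a, p)] [(p, b), (a, b)]"
    using dual_eq_triangles[of a p b n] assms by (auto intro: dual_eq.trans)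
  ultimately show ?thesis
    using letter_divides_suffix[of n w "u @ [(a, q)]" _ "[(p, b)]"] by auto
qed

text \<open>The same situation with the outer point \<open>a\<close> on the other side, beyond
  \<open>q\<close>: \<open>(b,q)(p,a)(p,q)\<close>, \<open>(b,q)(q,a)(p,a)\<close>,
  \<open>(q,a)(b,a)(p,a)\<close>, \<open>(q,a)(p,b)(b,a)\<close>.\<close>

lemma letter_divides_merge_below:
  assumes "dual_eq n w (u @ [(b, q), (p, a), (p, q)])" "1 \<le> p" "p < b" "b < q" "q < a" "a \<le> n"
  shows "letter_divides n (b, a) w"
proof -
  have "dual_eq n [(p, a), (p, q)] [(q, a), (p, a)]"
    using dual_eq_triangles[of p q a n] assms by (auto intro: dual_eq.trans)
  then have "dual_eq n w (u @ [(b, q), (q, a), (p, a)])"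
    using dual_eq_suffix[of n w "u @ [(b, q)]"] assms(1) by auto
  moreover have "dual_eq n ([(b, q), (q, a)] @ [(p, a)]) ([(q, a), (b, a)] @ [(p, a)])"
    using dual_eq_triangles(1)[of b q a n] assms
    by (intro dual_eq_append dual_eq.refl) (auto simp: gens_def)
  ultimately have "dual_eq n w (u @ [(q, a), (b, a), (p, a)])"
    using dual_eq_suffix by fastforce
  moreover have "dual_eq n [(b, a), (p, a)] [(p, b), (b, a)]"
    using dual_eq_triangles[of p b a n] assms by (auto intro: dual_eq.trans)
  ultimately show ?thesis
    using letter_divides_suffix[of n w "u @ [(q, a)]" _ "[(p, b)]"] by auto
qed

lemma chord_commute: "chord i j = chord j i"
  by (auto simp: chord_def)

text \<open>A pair related after the last letter either survived its cut, and then its chord moves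
  past the letter, or was created by its merge, and then is composed from chords at \<open>p\<close>
  and at \<open>q\<close>. The induction is on length because the chords are extracted from
  rewritten words that are no prefixes of \<open>w\<close>.\<close>

lemma letter_divides_if_alpha:
  "w \<in> lists (gens n) \<Longrightarrow> alpha w i j \<Longrightarrow> i \<noteq> j \<Longrightarrow> letter_divides n (chord i j) w"
proof (induction "length w" arbitrary: w i j rule: less_induct)
  case less
  note sym = equivp_symp[OF equivp_alpha]
  have "w \<noteq> []" using less.prems by (auto simp: alpha_def)
  then obtain w0 p q where w: "w = w0 @ [(p, q)]" by (metis append_butlast_last_id surj_pair)
  have w0: "w0 \<in> lists (gens n)" and pq: "(p, q) \<in> gens n"
    using less.prems(1) by (auto simp: w)
  have pq': "1 \<le> p" "p < q" "q \<le> n" using pq by (auto simp: gens_def)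
  have IH: "\<exists>u. dual_eq n w0 (u @ [chord k l])" if "alpha w0 k l" "k \<noteq> l" for k l
    using less.hyps[OF _ w0 that] by (simp add: w letter_divides_def)
  have ext: "dual_eq n w (u @ s @ [(p, q)])" if "dual_eq n w0 (u @ s)" for u s
    using dual_eq_append[OF that dual_eq.refl[of "[(p, q)]" n]] pq by (simp add: w)
  have merged: "letter_divides n (chord a b) w"
    if E: "alpha w0 a p" "alpha w0 q b" and arcs: "same_arc (p, q) a p" "same_arc (p, q) q b"
    for a b
  proof -
    have b: "p < b" "b \<le> q" using arcs(2) pq' by auto
    have a: "a \<le> p \<or> q < a" using arcs(1) pq' by auto
    have a': "a \<noteq> p \<Longrightarrow> 1 \<le> a \<and> a \<le> n" using alpha_points[OF w0 E(1)] by auto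
    consider "a = p" "b = q" | "a = p" "b \<noteq> q" | "a < p" "b = q" | "q < a" "b = q"
      | "a < p" "b < q" | "q < a" "b < q"
      using a b by linarith
    then show ?thesis
    proof cases
      case 1
      then show ?thesis
        using less.prems(1) pq' unfolding letter_divides_def w
        by (auto simp: chord_def intro!: exI[of _ w0] dual_eq.refl)
    next
      case 2
      then obtain u where "dual_eq n w0 (u @ [(b, q)])"
        using IH[OF E(2)] b by (auto simp: chord_def)
      then show ?thesis
        using letter_divides_suffix[OF ext, of u "[(b, q)]" "[(p, q)]"] 2 b
          dual_eq_triangles(2)[of p b q n] pq'
        by (auto simp: chord_def)
    next
      case 3
      then obtain u where "dual_eq n w0 (u @ [(a, p)])"
        using IH[OF E(1)] by (auto simp: chord_def)
      then show ?thesis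
        using letter_divides_suffix[OF ext, of u "[(a, p)]" "[(p, q)]"] 3 a'
          dual_eq_triangles(1)[of a p q n] pq'
        by (auto simp: chord_def)
    next
      case 4
      then obtain u where "dual_eq n w0 (u @ [(p, a)])"
        using IH[OF E(1)] pq' by (auto simp: chord_def)
      then show ?thesis
        using letter_divides_suffix[OF ext, of u "[(p, a)]" "[(p, q)]"] 4 a'
          dual_eq_triangles(3)[of p q a n] pq'
        by (auto simp: chord_def)
    next
      case 5
      then obtain u where u: "dual_eq n w0 (u @ [(a, p)])"
        using IH[OF E(1)] by (auto simp: chord_def)
      \<comment> \<open>The merge at \<open>(a, p)\<close> relates only points of opposite arcs. As
        \<open>q\<close> and \<open>b\<close> both lie outside its arc, their relation predates this
        letter, so the chord \<open>(b, q)\<close> can be extracted from \<open>u\<close> as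
        well.\<close>
      have "alpha w0 = step (alpha u) (a, p)"
        using alpha_dual_eq[OF u] by (simp add: alpha_snoc)
      then have "alpha u q b"
        using E(2) 5 b by (auto simp: step_def cut_def)
      moreover have "u \<in> lists (gens n)" "length u < length w"
        using dual_eq_lists[OF u] dual_eq_length[OF u] by (auto simp: w)
      ultimately have "letter_divides n (chord q b) u"
        using less.hyps[of u q b] 5 by simp
      then obtain v where v: "dual_eq n u (v @ [(b, q)])"
        using 5 by (auto simp: letter_divides_def chord_def)
      have "dual_eq n (u @ [(a, p)]) ((v @ [(b, q)]) @ [(a, p)])"
        using dual_eq_append[OF v dual_eq.refl[of "[(a, p)]"]] a' 5 pq' by (auto simp: gens_def)
      then have "dual_eq n w0 (v @ [(b, q), (a, p)])"
        using dual_eq.trans[OF u] by simp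
      then show ?thesis
        using letter_divides_merge_above[of n w v b q a p] ext a' 5 b pq'
        by (fastforce simp: chord_def)
    next
      case 6
      then obtain u where u: "dual_eq n w0 (u @ [(p, a)])"
        using IH[OF E(1)] pq' by (auto simp: chord_def)
      \<comment> \<open>Now \<open>q\<close> and \<open>b\<close> both lie inside the arc of
        \<open>(p, a)\<close>, with the same consequence.\<close>
      have "alpha w0 = step (alpha u) (p, a)"
        using alpha_dual_eq[OF u] by (simp add: alpha_snoc)
      then have "alpha u q b"
        using E(2) 6 b pq' by (auto simp: step_def cut_def)
      moreover have "u \<in> lists (gens n)" "length u < length w"
        using dual_eq_lists[OF u] dual_eq_length[OF u] by (auto simp: w)
      ultimately have "letter_divides n (chord q b) u"
        using less.hyps[of u q b] 6 by simp
      then obtain v where v: "dual_eq n u (v @ [(b, q)])"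
        using 6 by (auto simp: letter_divides_def chord_def)
      have "dual_eq n (u @ [(p, a)]) ((v @ [(b, q)]) @ [(p, a)])"
        using dual_eq_append[OF v dual_eq.refl[of "[(p, a)]"]] a' 6 pq' by (auto simp: gens_def)
      then have "dual_eq n w0 (v @ [(b, q), (p, a)])"
        using dual_eq.trans[OF u] by simp
      then show ?thesis
        using letter_divides_merge_below[of n w v b q p a] ext a' 6 b pq'
        by (fastforce simp: chord_def)
    qed
  qed
  consider "alpha w0 i j" "same_arc (p, q) i j"
    | "alpha w0 i p" "same_arc (p, q) i p" "alpha w0 q j" "same_arc (p, q) q j"
    | "alpha w0 i q" "same_arc (p, q) i q" "alpha w0 p j" "same_arc (p, q) p j"
    using less.prems(2) by (auto simp: w alpha_snoc step_def cut_def)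
  then show ?case
  proof cases
    case 1
    obtain k l where kl: "chord i j = (k, l)" "same_arc (p, q) k l"
      using 1(2) by (auto simp: chord_def min_def max_def)
    have "(k, l) \<in> gens n"
      using chord_gens[OF less.prems(3) alpha_points[OF w0 1(1) less.prems(3)]] kl by simp
    then obtain z where "dual_eq n [(k, l), (p, q)] [z, (k, l)]"
      using chord_past_letter pq kl by blast
    moreover obtain u where "dual_eq n w0 (u @ [(k, l)])"
      using IH[OF 1(1) less.prems(3)] kl by auto
    ultimately show ?thesis
      using letter_divides_suffix[OF ext, of u "[(k, l)]" "[z]"] kl by simp
  next
    case 2
    then show ?thesis by (intro merged)
  next
    case 3
    then show ?thesis
      using merged[of j i] sym chord_commute[of i j] by auto
  qed
qed

lemma letter_divides_iff_alpha:
  assumes "w \<in> lists (gens n)" "(i, j) \<in> gens n"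
  shows "letter_divides n (i, j) w \<longleftrightarrow> alpha w i j"
proof
  assume "letter_divides n (i, j) w"
  then show "alpha w i j"
    unfolding letter_divides_def using alpha_dual_eq alpha_last by metis
next
  assume "alpha w i j"
  moreover have "chord i j = (i, j)" "i \<noteq> j"
    using assms(2) by (auto simp: gens_def chord_def)
  ultimately show "letter_divides n (i, j) w"
    using letter_divides_if_alpha[OF assms(1)] by metis
qed

section \<open>The cyclic symmetry of \<open>alpha\<close>\<close>

definition rotate_point :: "nat \<Rightarrow> nat \<Rightarrow> nat" where
  "rotate_point n i = (if i < n then Suc i else 1)"

text \<open>For a letter ending at \<open>n\<close> the rotation exchanges inner and outer arc, but
  \<open>same_arc\<close> depends only on the unordered pair of arcs.\<close>

lemma same_arc_phi:
  assumes "x \<in> gens n" "i \<in> {1..n}" "j \<in> {1..n}"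
  shows "same_arc (phi n x) (rotate_point n i) (rotate_point n j) \<longleftrightarrow> same_arc x i j"
  using assms by (cases x) (auto simp: gens_def rotate_point_def)

lemma alpha_phi_word:
  assumes "w \<in> lists (gens n)" "i \<in> {1..n}" "j \<in> {1..n}"
  shows "alpha (phi_word n w) (rotate_point n i) (rotate_point n j) \<longleftrightarrow> alpha w i j"
  using assms
proof (induction w arbitrary: i j rule: rev_induct)
  case Nil
  then show ?case by (auto simp: phi_word_def alpha_def rotate_point_def)
next
  case (snoc x w)
  obtain p q where x: "x = (p, q)" by (meson surj_pair)
  have pq: "p \<in> {1..n}" "q \<in> {1..n}" "p < q" "x \<in> gens n"
    using snoc.prems(1) by (auto simp: x gens_def)
  have cut: "cut (phi n x) (alpha (phi_word n w)) (rotate_point n k) (rotate_point n l)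
      \<longleftrightarrow> cut x (alpha w) k l" if "k \<in> {1..n}" "l \<in> {1..n}" for k l
    using snoc that same_arc_phi[OF pq(4) that] by (simp add: cut_def)
  \<comment> \<open>The order of the endpoints may be reversed; \<open>merge\<close> is symmetric in
    them.\<close>
  have phi: "phi n x = (rotate_point n p, rotate_point n q) \<or> phi n x = (rotate_point n q, rotate_point n p)"
    using pq by (auto simp: x rotate_point_def)
  have "merge (phi n x) E i j \<longleftrightarrow> merge (rotate_point n p, rotate_point n q) E i j" for E i j
    using phi by auto
  then show ?case
    using snoc.prems pq(1,2) cut
    by (simp add: alpha_snoc phi_word_def step_def) (simp add: x)
qed

section \<open>Trivial tails\<close>

definition tail_free :: "nat \<Rightarrow> braid_word \<Rightarrow> bool" where
  "tail_free n w \<longleftrightarrow> (\<forall>i j. alpha w i j \<longrightarrow> i < j \<longrightarrow> j = n)"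

text \<open>Relations preserve length, so no letter divides the trivial braid. Conversely, a divisor
  from the lower submonoid has a representative over \<open>gens (n - 1)\<close>, and the last
  letter of that word would divide.\<close>

lemma is_tail_one_iff_no_letter:
  assumes w: "w \<in> lists (gens n)"
  shows "is_tail n (braid_of n w) \<one>\<^bsub>dual_braid_monoid n\<^esub> \<longleftrightarrow>
    (\<forall>x \<in> gens (n - 1). \<not> letter_divides n x w)"
proof
  assume tail: "is_tail n (braid_of n w) \<one>\<^bsub>dual_braid_monoid n\<^esub>"
  show "\<forall>x \<in> gens (n - 1). \<not> letter_divides n x w"
  proof (intro ballI notI)
    fix x assume x: "x \<in> gens (n - 1)" and "letter_divides n x w"
    then obtain u where u: "dual_eq n w (u @ [x])" by (auto simp: letter_divides_def)
    have ul: "u \<in> lists (gens n)" "[x] \<in> lists (gens n)" using dual_eq_lists[OF u] by auto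
    have "braid_of n [x] \<in> lower_submonoid n"
      using x embed_braid_of[of "[x]" n] braid_of_in_carrier[of "[x]" "n - 1"]
      unfolding lower_submonoid_def by (metis image_eqI Cons_in_lists_iff lists.Nil)
    moreover have "right_divisor n (braid_of n [x]) (braid_of n w)"
      using u ul w dual_eq_lists[OF u]
      unfolding right_divisor_def carrier_dual_braid_monoid
      by (auto intro!: bexI[of _ "u"] simp: mult_braid_of braid_of_eq_iff)
    ultimately have "right_divisor n (braid_of n [x]) \<one>\<^bsub>dual_braid_monoid n\<^esub>"
      using tail by (simp add: is_tail_def)
    then obtain v where "v \<in> lists (gens n)" "braid_of n [] = braid_of n (v @ [x])"
      using ul by (auto simp: right_divisor_def carrier_dual_braid_monoid one_dual_braid_monoid
          mult_braid_of)
    then have "dual_eq n [] (v @ [x])"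
      using ul by (subst (asm) braid_of_eq_iff) auto
    then show False using dual_eq_length by fastforce
  qed
next
  assume no: "\<forall>x \<in> gens (n - 1). \<not> letter_divides n x w"
  have one: "braid_of n [] \<in> lower_submonoid n"
    unfolding lower_submonoid_def carrier_dual_braid_monoid
    by (intro image_eqI[of _ _ "braid_of (n - 1) []"] imageI) (simp_all add: embed_braid_of[simplified])
  have div: "right_divisor n (braid_of n []) (braid_of n v)" if "v \<in> lists (gens n)" for v
    using mult_braid_of[OF that, of "[]"] braid_of_in_carrier[OF that]
    unfolding right_divisor_def by (intro bexI[of _ "braid_of n v"]) auto
  have "right_divisor n \<delta> (braid_of n [])"
    if lower: "\<delta> \<in> lower_submonoid n" and divides: "right_divisor n \<delta> (braid_of n w)" for \<delta>
  proof -
    from lower obtain d where d: "d \<in> lists (gens (n - 1))" "\<delta> = embed n (braid_of (n - 1) d)"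
      unfolding lower_submonoid_def carrier_dual_braid_monoid by (elim imageE) blast
    note d = d(1) d(2)[unfolded embed_braid_of[OF d(1)]]
    have dl: "d \<in> lists (gens n)" using lists_gens_pred[OF d(1)] .
    obtain u where u: "u \<in> lists (gens n)" "braid_of n w = braid_of n (u @ d)"
      using divides d dl by (auto simp: right_divisor_def carrier_dual_braid_monoid mult_braid_of)
    have eq: "dual_eq n w (u @ d)"
      using u dl w by (subst (asm) braid_of_eq_iff) auto
    have "d = []"
    proof (rule ccontr)
      assume "d \<noteq> []"
      then obtain d' x where dx: "d = d' @ [x]" by (metis append_butlast_last_id)
      have "letter_divides n x w"
        using eq unfolding letter_divides_def dx by (metis append_assoc)
      then show False using no d(1) dx by auto
    qed
    then show ?thesis using d div[of "[]"] by simp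
  qed
  then show "is_tail n (braid_of n w) \<one>\<^bsub>dual_braid_monoid n\<^esub>"
    using one div[OF w] by (simp add: is_tail_def one_dual_braid_monoid)
qed

lemma is_tail_one_iff:
  assumes w: "w \<in> lists (gens n)"
  shows "is_tail n (braid_of n w) \<one>\<^bsub>dual_braid_monoid n\<^esub> \<longleftrightarrow> tail_free n w"
proof -
  have "(\<forall>x \<in> gens (n - 1). \<not> letter_divides n x w) \<longleftrightarrow>
      (\<forall>i j. (i, j) \<in> gens (n - 1) \<longrightarrow> \<not> alpha w i j)"
    using letter_divides_iff_alpha[OF w] gens_mono[of "n - 1" n] by auto
  also have "\<dots> \<longleftrightarrow> tail_free n w"
  proof -
    have "j = n \<longleftrightarrow> (i, j) \<notin> gens (n - 1)" if "alpha w i j" "i < j" for i j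
      using alpha_points[OF w that(1)] that(2) by (auto simp: gens_def)
    moreover have "i < j" if "(i, j) \<in> gens (n - 1)" for i j
      using that by (simp add: gens_def)
    ultimately show ?thesis unfolding tail_free_def by metis
  qed
  finally show ?thesis using is_tail_one_iff_no_letter[OF w] by simp
qed

lemma rotate_point_surj:
  assumes "k \<in> {1..n}" shows "\<exists>i \<in> {1..n}. k = rotate_point n i"
proof (cases "k = 1")
  case True
  then show ?thesis using assms by (intro bexI[of _ n]) (auto simp: rotate_point_def)
next
  case False
  then show ?thesis using assms by (intro bexI[of _ "k - 1"]) (auto simp: rotate_point_def)
qed

text \<open>The point rotated onto \<open>n\<close> is \<open>n - 1\<close>, so the condition is
  pulled back to unrotated coordinates, where the next block can be analysed.\<close>

lemma tail_free_phi_word: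
  assumes w: "w \<in> lists (gens n)" and n: "n \<ge> 2"
  shows "tail_free n (phi_word n w) \<longleftrightarrow>
    (\<forall>i j. alpha w i j \<longrightarrow> i \<noteq> j \<longrightarrow> i = n - 1 \<or> j = n - 1)"
proof
  assume tf: "tail_free n (phi_word n w)"
  show "\<forall>i j. alpha w i j \<longrightarrow> i \<noteq> j \<longrightarrow> i = n - 1 \<or> j = n - 1"
  proof (intro allI impI)
    fix i j assume *: "alpha w i j" "i \<noteq> j"
    have ij: "i \<in> {1..n}" "j \<in> {1..n}" using alpha_points[OF w *] by auto
    have "alpha (phi_word n w) (rotate_point n i) (rotate_point n j)"
      "alpha (phi_word n w) (rotate_point n j) (rotate_point n i)"
      using alpha_phi_word[OF w] ij *(1) equivp_symp[OF equivp_alpha] by auto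
    moreover have "rotate_point n i \<noteq> rotate_point n j"
      using *(2) ij by (auto simp: rotate_point_def)
    ultimately have "rotate_point n i = n \<or> rotate_point n j = n"
      using tf unfolding tail_free_def by (metis linorder_neqE_nat)
    then show "i = n - 1 \<or> j = n - 1"
      using n by (auto simp: rotate_point_def split: if_splits)
  qed
next
  assume R: "\<forall>i j. alpha w i j \<longrightarrow> i \<noteq> j \<longrightarrow> i = n - 1 \<or> j = n - 1"
  show "tail_free n (phi_word n w)"
    unfolding tail_free_def
  proof (intro allI impI)
    fix k l assume *: "alpha (phi_word n w) k l" "k < l"
    have "{k, l} \<subseteq> {1..n}" using alpha_points[OF phi_word_lists[OF w] *(1)] *(2) by simp
    then obtain i j where ij: "i \<in> {1..n}" "j \<in> {1..n}" "k = rotate_point n i" "l = rotate_point n j"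
      using rotate_point_surj[of k n] rotate_point_surj[of l n] by auto
    then have "i = n - 1 \<or> j = n - 1"
      using R alpha_phi_word[OF w ij(1,2)] * by auto
    then show "l = n"
      using n ij * by (auto simp: rotate_point_def split: if_splits)
  qed
qed

definition single_chord :: "braid_word \<Rightarrow> nat \<Rightarrow> nat \<Rightarrow> bool" where
  "single_chord w a b \<longleftrightarrow>
    (\<forall>i j. alpha w i j \<longleftrightarrow> i = j \<or> (i = a \<and> j = b) \<or> (i = b \<and> j = a))"

text \<open>A further point related to \<open>c\<close> would by transitivity be related to
  \<open>a\<close>, giving a pair that avoids \<open>c\<close>.\<close>

lemma single_chord_if_star:
  assumes "alpha w a c" "a \<noteq> c" "\<And>i j. alpha w i j \<Longrightarrow> i \<noteq> j \<Longrightarrow> i = c \<or> j = c"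
  shows "single_chord w a c"
  unfolding single_chord_def
proof (intro allI iffI)
  note r = equivp_reflp[OF equivp_alpha[of w]] and s = equivp_symp[OF equivp_alpha[of w]]
    and t = equivp_transp[OF equivp_alpha[of w]]
  fix i j
  have star: "j = a" if "alpha w c j" "j \<noteq> c" for j
    using assms(3)[OF t[OF assms(1) that(1)]] assms(2) that(2) by auto
  show "alpha w i j \<Longrightarrow> i = j \<or> (i = a \<and> j = c) \<or> (i = c \<and> j = a)"
    using assms(3)[of i j] star[of i] star[of j] s[of i j] by blast
  show "i = j \<or> (i = a \<and> j = c) \<or> (i = c \<and> j = a) \<Longrightarrow> alpha w i j"
    using assms(1) r s by auto
qed

lemma single_chord_phi_word:
  assumes "single_chord w a b" "w \<in> lists (gens n)" "a \<in> {1..n}" "b \<in> {1..n}" "a \<noteq> b"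
  shows "single_chord (phi_word n w) (rotate_point n a) (rotate_point n b)"
proof -
  have r: "alpha (phi_word n w) i i" for i
    by (rule equivp_reflp[OF equivp_alpha])
  have "rotate_point n a \<in> {1..n}" "rotate_point n b \<in> {1..n}"
    using assms by (auto simp: rotate_point_def)
  show ?thesis
    unfolding single_chord_def
  proof (intro allI)
    fix k l
    show "alpha (phi_word n w) k l \<longleftrightarrow> k = l \<or> (k = rotate_point n a \<and> l = rotate_point n b) \<or>
        (k = rotate_point n b \<and> l = rotate_point n a)"
    proof (cases "k \<noteq> l \<and> k \<in> {1..n} \<and> l \<in> {1..n}")
      case True
      then obtain i j where ij: "i \<in> {1..n}" "j \<in> {1..n}" "k = rotate_point n i" "l = rotate_point n j"
        using rotate_point_surj[of k n] rotate_point_surj[of l n] by auto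
      have inj: "rotate_point n i = rotate_point n j \<longleftrightarrow> i = j" if "i \<in> {1..n}" "j \<in> {1..n}" for i j
        using that by (auto simp: rotate_point_def)
      show ?thesis
        using alpha_phi_word[OF assms(2) ij(1,2)] assms(1,3,4) ij inj by (simp add: single_chord_def)
    next
      case False
      then show ?thesis
        using alpha_points[OF phi_word_lists[OF assms(2)], of k l] r assms
        by (auto simp: rotate_point_def)
    qed
  qed
qed

section \<open>Barriers\<close>

lemma alpha_snoc_iff:
  "alpha (w @ [(p, q)]) i j \<longleftrightarrow>
    (alpha w i j \<and> same_arc (p, q) i j) \<or>
    (alpha w i p \<and> same_arc (p, q) i p \<and> alpha w q j \<and> same_arc (p, q) q j) \<or>
    (alpha w i q \<and> same_arc (p, q) i q \<and> alpha w p j \<and> same_arc (p, q) p j)"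
  by (auto simp: alpha_snoc step_def cut_def)

context
  fixes h :: braid_word and s n :: nat
  assumes h: "single_chord h s n" "h \<in> lists (gens n)" and s: "1 \<le> s" "s < n"
begin

text \<open>The prefix \<open>h\<close>, a rotated product of the blocks to the left, relates no two
  distinct points below \<open>n\<close>; and the letters of \<open>w\<close> have both endpoints
  below \<open>n\<close>, so their effect on such points never refers to \<open>n\<close>.\<close>

lemma alpha_prefix_below:
  assumes "w \<in> lists (gens (n - 1))" "i < n" "j < n"
  shows "alpha (h @ w) i j \<longleftrightarrow> alpha w i j"
  using assms
proof (induction w arbitrary: i j rule: rev_induct)
  case Nil
  then show ?case using h(1) by (auto simp: single_chord_def alpha_def[of "[]"])
next
  case (snoc x w)
  obtain p q where x: "x = (p, q)" by (meson surj_pair)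
  have pq: "p < q" "q < n" using snoc.prems(1) s by (auto simp: x gens_def)
  show ?case
    using snoc pq unfolding x append_assoc[symmetric] by (simp add: alpha_snoc_iff del: append_assoc)
qed

text \<open>The point \<open>n\<close> is always in the outer arc, with \<open>p\<close>. So a
  letter attaches points to its block only if \<open>p\<close> is in it already, and these points
  lie above \<open>p\<close>.\<close>

lemma block_of_n_ge:
  assumes "w \<in> lists (gens (n - 1))" "x < n" "alpha (h @ w) n x"
  shows "s \<le> x"
  using assms
proof (induction w arbitrary: x rule: rev_induct)
  case Nil
  then show ?case using h(1) by (auto simp: single_chord_def)
next
  case (snoc y w)
  obtain p q where y: "y = (p, q)" by (meson surj_pair)
  have pq: "p < q" "q < n" using snoc.prems(1) s by (auto simp: y gens_def)
  show ?case
    using snoc.prems snoc.IH[of x] snoc.IH[of p] pq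
    unfolding y append_assoc[symmetric] by (auto simp: alpha_snoc_iff simp del: append_assoc)
qed

text \<open>Since letters only attach larger points to the block of \<open>n\<close>, a letter crossing over \<open>s\<close> leaves
  a chord below that whole block, and such a chord persists in some form.\<close>

lemma barrier_invariant:
  assumes "w \<in> lists (gens (n - 1))" "(p0, q0) \<in> set w" "p0 < s" "s < q0"
  shows "(\<forall>x<n. \<not> alpha (h @ w) n x) \<or>
    (\<exists>a b. a < b \<and> alpha (h @ w) a b \<and> (\<forall>x<n. alpha (h @ w) n x \<longrightarrow> b < x))"
  using assms(1,2)
proof (induction w rule: rev_induct)
  case (snoc y w)
  obtain p q where y: "y = (p, q)" by (meson surj_pair)
  have pq: "p < q" "q < n" using snoc.prems(1) s by (auto simp: y gens_def)
  have w: "w \<in> lists (gens (n - 1))" using snoc.prems(1) by simp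
  have step: "alpha (h @ w @ [(p, q)]) n x \<longleftrightarrow>
      (alpha (h @ w) n x \<and> \<not> (p < x \<and> x \<le> q)) \<or>
      (alpha (h @ w) n p \<and> alpha (h @ w) q x \<and> p < x \<and> x \<le> q)" for x
    using alpha_snoc_iff[of "h @ w" p q n x] pq by auto
  have new: "alpha (h @ w @ [(p, q)]) p q"
    using alpha_last[of "h @ w" p q] by simp
  show ?case
  proof (cases "p < s \<and> s < q")
    case True
    \<comment> \<open>Here \<open>p < s\<close> is not in the block of \<open>n\<close>, so the
      letter attaches nothing and cuts off everything up to \<open>q\<close>; the new chord
      \<open>(p, q)\<close> lies below what remains.\<close>
    have "q < x" if "x < n" "alpha (h @ w @ [(p, q)]) n x" for x
      using that True step[of x] block_of_n_ge[OF w, of x] block_of_n_ge[OF w, of p] pq by auto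
    then show ?thesis using new pq unfolding y by blast
  next
    case False
    then have "(p0, q0) \<in> set w" using snoc.prems(2) assms(3,4) by (auto simp: y)
    then consider "\<forall>x<n. \<not> alpha (h @ w) n x"
      | a b where "a < b" "alpha (h @ w) a b" "\<forall>x<n. alpha (h @ w) n x \<longrightarrow> b < x"
      using snoc.IH[OF w] by blast
    then show ?thesis
    proof cases
      case 1
      then show ?thesis using step pq unfolding y by (meson order_less_trans)
    next
      case (2 a b)
      show ?thesis
      proof (cases "same_arc (p, q) a b")
        case True
        then have "alpha (h @ w @ [(p, q)]) a b"
          using alpha_snoc_iff[of "h @ w" p q a b] 2(2) by simp
        moreover have "b < x" if "x < n" "alpha (h @ w @ [(p, q)]) n x" for x
          using that step[of x] 2(3) pq by (meson order_less_trans)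
        ultimately show ?thesis using 2(1) unfolding y by blast
      next
        case False
        \<comment> \<open>The letter separates \<open>a\<close> from \<open>b\<close>, which forces
          \<open>p < b\<close>; hence \<open>p\<close> is not in the block of \<open>n\<close>, and
          \<open>(p, q)\<close> takes over the role of the chord \<open>(a, b)\<close>.\<close>
        have "q < x" if "x < n" "alpha (h @ w @ [(p, q)]) n x" for x
        proof -
          have "\<not> alpha (h @ w) n p" using 2(1) 2(3)[rule_format, of p] False pq by auto
          then have "alpha (h @ w) n x" "\<not> (p < x \<and> x \<le> q)" using step that by auto
          then show ?thesis using 2(1) 2(3)[rule_format, of x] False that(1) pq by auto
        qed
        then show ?thesis using new pq unfolding y by blast
      qed
    qed
  qed
qed simp

text \<open>The last letter with \<open>q \<le> s\<close> creates such a pair, and every later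
  letter starts at \<open>s\<close> or above, so both points stay in its outer arc.\<close>

lemma no_barrier_chord:
  assumes "w \<in> lists (gens (n - 1))" "\<And>p q. (p, q) \<in> set w \<Longrightarrow> q \<le> s \<or> s \<le> p"
    "\<exists>(p, q) \<in> set w. q \<le> s"
  shows "\<exists>a b. a < b \<and> b \<le> s \<and> alpha w a b"
  using assms
proof (induction w rule: rev_induct)
  case (snoc y w)
  obtain p q where y: "y = (p, q)" by (meson surj_pair)
  have pq: "p < q" "q < n" using snoc.prems(1) s by (auto simp: y gens_def)
  show ?case
  proof (cases "q \<le> s")
    case True
    then show ?thesis using alpha_last[of w p q] pq by (auto simp: y)
  next
    case False
    then have "s \<le> p" using snoc.prems(2)[of p q] by (auto simp: y)
    moreover obtain a b where "a < b" "b \<le> s" "alpha w a b"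
      using snoc False by (auto simp: y)
    ultimately show ?thesis by (intro exI[of _ a] exI[of _ b]) (auto simp: y alpha_snoc_iff)
  qed
qed simp

text \<open>Both \<open>s\<close> and \<open>n\<close> lie in the outer arc of every letter, so no
  cut separates them.\<close>

lemma no_barrier_keeps_chord:
  assumes "w \<in> lists (gens (n - 1))" "\<And>p q. (p, q) \<in> set w \<Longrightarrow> s \<le> p"
  shows "alpha (h @ w) n s"
  using assms
proof (induction w rule: rev_induct)
  case Nil
  then show ?case using h(1) by (simp add: single_chord_def)
next
  case (snoc y w)
  obtain p q where y: "y = (p, q)" by (meson surj_pair)
  have "p < q" "q < n" "s \<le> p" using snoc.prems s by (auto simp: y gens_def)
  then show ?case
    using snoc unfolding y append_assoc[symmetric] by (auto simp: alpha_snoc_iff simp del: append_assoc)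
qed

text \<open>Below \<open>n\<close> only the chord of \<open>w\<close> itself is visible, so what
  remains is to show that \<open>n\<close> has become isolated.\<close>

lemma single_chord_append:
  assumes w: "w \<in> lists (gens (n - 1))" "w \<noteq> []" "last w = (t, n - 1)" "single_chord w t (n - 1)"
    and barrier: "s = n - 1 \<or> (\<exists>(p, q) \<in> set w. p < s \<and> s < q)"
  shows "single_chord (h @ w) t (n - 1)"
proof -
  have "(t, n - 1) \<in> gens (n - 1)" using w by (metis in_listsD last_in_set)
  then have t: "1 \<le> t" "t < n - 1" by (auto simp: gens_def)
  have below: "alpha (h @ w) i j \<longleftrightarrow> i = j \<or> (i = t \<and> j = n - 1) \<or> (i = n - 1 \<and> j = t)"
    if "i < n" "j < n" for i j
    using alpha_prefix_below[OF w(1) that] w(4) by (simp add: single_chord_def)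
  have isolated: "\<not> alpha (h @ w) n x" if x: "x < n" for x
    using barrier
  proof
    assume s': "s = n - 1"
    \<comment> \<open>Before the last letter the block of \<open>n\<close> contains nothing below
      \<open>s = n - 1\<close>. The last letter has \<open>n - 1\<close> as inner endpoint, hence
      separates it from \<open>n\<close>, and its other endpoint \<open>t\<close> is too small to
      lie in that block.\<close>
    obtain w0 where w0: "w = w0 @ [(t, n - 1)]" using w(2,3) by (metis append_butlast_last_id)
    have "w0 \<in> lists (gens (n - 1))" using w(1) by (simp add: w0)
    note ge = block_of_n_ge[OF this]
    show ?thesis
      using ge[of x] ge[of t] alpha_snoc_iff[of "h @ w0" t "n - 1" n x] t s s' x by (auto simp: w0)
  next
    assume "\<exists>(p, q) \<in> set w. p < s \<and> s < q"
    then obtain p0 q0 where "(p0, q0) \<in> set w" "p0 < s" "s < q0" by auto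
    from barrier_invariant[OF w(1) this] show ?thesis
    proof
      assume "\<exists>a b. a < b \<and> alpha (h @ w) a b \<and> (\<forall>x<n. alpha (h @ w) n x \<longrightarrow> b < x)"
      then obtain a b where ab: "a < b" "alpha (h @ w) a b" "\<And>x. x < n \<Longrightarrow> alpha (h @ w) n x \<Longrightarrow> b < x"
        by blast
      show ?thesis
      proof
        assume "alpha (h @ w) n x"
        then have "b < x" using ab(3) x by blast
        \<comment> \<open>The only pair of distinct points below \<open>n\<close> is
          \<open>{t, n - 1}\<close>, so \<open>b = n - 1\<close>, and there is no \<open>x\<close>
          strictly between \<open>b\<close> and \<open>n\<close>.\<close>
        then show False using below[of a b] ab x by auto
      qed
    qed (use x in blast)
  qed
  have points: "{i, j} \<subseteq> {1..n}" if "alpha (h @ w) i j" "i \<noteq> j" for i j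
    using alpha_points[OF _ that, of n] h(2) w(1) lists_gens_pred[OF w(1)] by simp
  show ?thesis
  proof (rule single_chord_if_star)
    show "alpha (h @ w) t (n - 1)" "t \<noteq> n - 1"
      using below[of t "n - 1"] t by auto
    fix i j assume ij: "alpha (h @ w) i j" "i \<noteq> j"
    have "alpha (h @ w) j i"
      using ij(1) by (rule equivp_symp[OF equivp_alpha])
    with ij have "i \<noteq> n" "j \<noteq> n"
      using isolated[of i] isolated[of j] points[OF ij] by auto
    then show "i = n - 1 \<or> j = n - 1"
      using ij below[of i j] points[OF ij] by auto
  qed
qed

text \<open>Without a barrier every letter lies weakly on one side of \<open>s\<close>. A letter on
  the left leaves a pair within \<open>{1..s}\<close>, which cannot be \<open>{t, n - 1}\<close>; if
  all are on the right, the pair \<open>{s, n}\<close> survives.\<close>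

lemma barrier_if_no_other_chord:
  assumes w: "w \<in> lists (gens (n - 1))" "w \<noteq> []" "last w = (t, n - 1)" "single_chord w t (n - 1)"
    and star: "\<And>i j. alpha (h @ w) i j \<Longrightarrow> i \<noteq> j \<Longrightarrow> i = n - 1 \<or> j = n - 1"
  shows "s = n - 1 \<or> (\<exists>(p, q) \<in> set w. p < s \<and> s < q)"
proof (rule ccontr)
  assume neg: "\<not> ?thesis"
  then have nb: "q \<le> s \<or> s \<le> p" if "(p, q) \<in> set w" for p q using that by force
  show False
  proof (cases "\<exists>(p, q) \<in> set w. q \<le> s")
    case True
    then obtain a b where "a < b" "b \<le> s" "alpha w a b"
      using no_barrier_chord[OF w(1) nb] by blast
    then show False using w(4) neg s by (auto simp: single_chord_def)
  next
    case False
    then have "alpha (h @ w) n s" using no_barrier_keeps_chord[OF w(1)] nb by blast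
    then show False using star neg s by force
  qed
qed

end

section \<open>Rotating words as sequences of blocks\<close>

lemma rotating_nf_braid_of:
  "rotating_nf n \<beta> w \<Longrightarrow> w \<in> lists (gens n) \<and> \<beta> = braid_of n w"
proof (induction rule: rotating_nf.induct)
  case (two \<beta> k)
  then obtain u where "u \<in> lists (gens 2)" "\<beta> = braid_of 2 u"
    by (auto simp: carrier_dual_braid_monoid)
  moreover from this have "dual_eq 2 u (replicate k (1, 2))"
    using two(2) by (simp add: in_braid_of)
  ultimately show ?case
    using dual_eq_lists braid_of_eq_iff by metis
next
  case (trivial n)
  then show ?case by (simp add: one_dual_braid_monoid)
next
  case (split n \<beta> bs ws)
  have ws: "ws \<in> lists (lists (gens (n - 1))) \<and> bs = map (braid_of (n - 1)) ws"
    using split.IH by (induction rule: list_all2_induct) auto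
  have "\<beta> = rot_prod n 0 bs" using split(4) unfolding is_splitting_def by blast
  also have "\<dots> = braid_of n (rot_word n ws)"
    using rot_prod_braid_of[of ws n 0] ws by simp
  finally show ?case using rot_word_lists[of ws n] ws by blast
qed

lemma rotating_words_lists: "w \<in> rotating_words n \<Longrightarrow> w \<in> lists (gens n)"
  unfolding rotating_words_def by (auto dest: rotating_nf_braid_of)

lemma rotating_words_iff: "w \<in> rotating_words n \<longleftrightarrow> rotating_nf n (braid_of n w) w"
  unfolding rotating_words_def
  by (auto dest: rotating_nf_braid_of intro!: bexI[of _ "braid_of n w"] braid_of_in_carrier)

text \<open>Blocks are listed in the order \<open>w\<^bsub>1\<^esub>, \<dots>, w\<^bsub>b\<^esub>\<close> in which the automaton meets them.\<close>

fun block_word :: "nat \<Rightarrow> braid_word list \<Rightarrow> braid_word" where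
  "block_word n [] = []"
| "block_word n (u # us) = phi_word n (block_word n us) @ u"

fun splits :: "nat \<Rightarrow> braid_word list \<Rightarrow> bool" where
  "splits n [] \<longleftrightarrow> False"
| "splits n (u # us) \<longleftrightarrow> u \<in> rotating_words (n - 1) \<and>
    (if us = [] then u \<noteq> [] else tail_free n (phi_word n (block_word n us)) \<and> splits n us)"

lemma rot_word_snoc: "rot_word n (ws @ [w]) = phi_word n (rot_word n ws) @ w"
  by (induction ws) auto

lemma rot_word_rev: "rot_word n (rev us) = block_word n us"
  by (induction us) (auto simp: rot_word_snoc)

lemma block_word_lists:
  "us \<in> lists (lists (gens (n - 1))) \<Longrightarrow> block_word n us \<in> lists (gens n)"
  using rot_word_lists[of "rev us" n] by (simp add: rot_word_rev in_lists_conv_set)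

lemma splits_iff:
  "splits n us \<longleftrightarrow> us \<noteq> [] \<and> set us \<subseteq> rotating_words (n - 1) \<and> last us \<noteq> [] \<and>
    (\<forall>k. 1 \<le> k \<and> k < length us \<longrightarrow> tail_free n (phi_word n (block_word n (drop k us))))"
proof (induction us)
  case (Cons u us)
  have shift: "(\<forall>k. 1 \<le> k \<and> k < length (u # us) \<longrightarrow> Q (drop k (u # us))) \<longleftrightarrow>
      (us \<noteq> [] \<longrightarrow> Q us) \<and> (\<forall>k. 1 \<le> k \<and> k < length us \<longrightarrow> Q (drop k us))" for Q
  proof (intro iffI conjI allI impI)
    assume *: "\<forall>k. 1 \<le> k \<and> k < length (u # us) \<longrightarrow> Q (drop k (u # us))"
    show "us \<noteq> [] \<Longrightarrow> Q us" using *[rule_format, of 1] by simp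
    show "1 \<le> k \<and> k < length us \<Longrightarrow> Q (drop k us)" for k
      using *[rule_format, of "Suc k"] by simp
  next
    fix k assume *: "(us \<noteq> [] \<longrightarrow> Q us) \<and> (\<forall>k. 1 \<le> k \<and> k < length us \<longrightarrow> Q (drop k us))"
      "1 \<le> k \<and> k < length (u # us)"
    then obtain k' where "k = Suc k'" "k' < length us" by (cases k) auto
    then show "Q (drop k (u # us))" using * by (cases k') auto
  qed
  show ?case
    unfolding shift[of "\<lambda>us. tail_free n (phi_word n (block_word n us))"] splits.simps Cons.IH
    by auto
qed simp

lemma splits_lists: "splits n us \<Longrightarrow> us \<in> lists (lists (gens (n - 1)))"
  using rotating_words_lists by (auto simp: splits_iff in_lists_conv_set)

lemma block_word_eq_Nil: "block_word n us = [] \<Longrightarrow> u \<in> set us \<Longrightarrow> u = []"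
  by (induction us) (auto simp: phi_word_def)

text \<open>Reversal turns taking the first \<open>b - k\<close> braids into dropping
  \<open>k\<close> blocks. The leading braid is trivial exactly if its word is empty, since
  relations preserve length.\<close>

lemma is_splitting_braid_of:
  assumes "us \<in> lists (lists (gens (n - 1)))"
  shows "is_splitting n (braid_of n (block_word n us)) (map (braid_of (n - 1)) (rev us)) \<longleftrightarrow>
    us \<noteq> [] \<and> last us \<noteq> [] \<and>
    (\<forall>k. 1 \<le> k \<and> k < length us \<longrightarrow> tail_free n (phi_word n (block_word n (drop k us))))"
proof -
  let ?bs = "map (braid_of (n - 1)) (rev us)"
  have L: "rev vs \<in> lists (lists (gens (n - 1)))" if "set vs \<subseteq> set us" for vs
    using assms that by (auto simp only: in_lists_conv_set set_rev)
  have prod: "rot_prod n 0 ?bs = braid_of n (block_word n us)"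
    using rot_prod_braid_of[OF L[of us], of 0] by (simp add: rot_word_rev)
  have tail: "rot_prod n 1 (take (length ?bs - k) ?bs) =
      braid_of n (phi_word n (block_word n (drop k us)))" if "k < length us" for k
    using rot_prod_braid_of[OF L[of "drop k us"], of 1] set_drop_subset[of k us] that
    by (simp add: rot_word_rev take_map rev_drop[symmetric] take_rev)
  have carr: "set ?bs \<subseteq> carrier (dual_braid_monoid (n - 1))"
    using assms by (auto simp only: in_lists_conv_set set_map set_rev intro: braid_of_in_carrier)
  have hd: "hd ?bs \<noteq> \<one>\<^bsub>dual_braid_monoid (n - 1)\<^esub> \<longleftrightarrow> last us \<noteq> []" if "us \<noteq> []"
  proof -
    have "last us \<in> lists (gens (n - 1))" using assms that by (metis in_listsD last_in_set)
    then have "braid_of (n - 1) (last us) = braid_of (n - 1) [] \<longleftrightarrow> last us = []"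
      using braid_of_eq_iff[of "last us" "n - 1" "[]"] dual_eq_length by fastforce
    then show ?thesis using that by (simp add: hd_map hd_rev one_dual_braid_monoid)
  qed
  have free: "is_tail n (rot_prod n 1 (take (length ?bs - k) ?bs)) \<one>\<^bsub>dual_braid_monoid n\<^esub> \<longleftrightarrow>
      tail_free n (phi_word n (block_word n (drop k us)))" if "k < length us" for k
  proof -
    have "drop k us \<in> lists (lists (gens (n - 1)))"
      using assms set_drop_subset[of k us] by (auto simp only: in_lists_conv_set)
    then show ?thesis
      unfolding tail[OF that] by (intro is_tail_one_iff phi_word_lists block_word_lists)
  qed
  show ?thesis
  proof (cases "us = []")
    case False
    have len: "length ?bs = length us" by simp
    show ?thesis
      unfolding is_splitting_def prod using carr hd[OF False] free False by (auto simp: len)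
  qed (simp add: is_splitting_def)
qed

lemma rotating_words_iff_splits:
  assumes "n \<ge> 3"
  shows "w \<in> rotating_words n \<longleftrightarrow> w = [] \<or> (\<exists>us. splits n us \<and> w = block_word n us)"
proof
  assume "w \<in> rotating_words n"
  then have "rotating_nf n (braid_of n w) w" by (simp add: rotating_words_iff)
  then show "w = [] \<or> (\<exists>us. splits n us \<and> w = block_word n us)"
  proof cases
    case (split bs ws)
    have "ws \<in> lists (lists (gens (n - 1))) \<and> bs = map (braid_of (n - 1)) ws
        \<and> set ws \<subseteq> rotating_words (n - 1)"
      using split(6)
    proof (induction rule: list_all2_induct)
      case (Cons b bs w ws)
      then show ?case
        using rotating_nf_braid_of[OF Cons(1)] by (auto simp: rotating_words_iff)
    qed simp
    then have "splits n (rev ws)"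
      using split(5) is_splitting_braid_of[of "rev ws" n] split(1)
      by (simp add: splits_iff rot_word_rev[symmetric] in_lists_conv_set)
    then show ?thesis
      using split(1) by (intro disjI2 exI[of _ "rev ws"]) (simp add: rot_word_rev[symmetric])
  qed (use assms in auto)
next
  assume "w = [] \<or> (\<exists>us. splits n us \<and> w = block_word n us)"
  then show "w \<in> rotating_words n"
  proof
    assume "w = []"
    then show ?thesis
      using rotating_nf.trivial[OF assms] by (simp add: rotating_words_iff one_dual_braid_monoid)
  next
    assume "\<exists>us. splits n us \<and> w = block_word n us"
    then obtain us where us: "splits n us" "w = block_word n us" by blast
    have L: "us \<in> lists (lists (gens (n - 1)))" using splits_lists[OF us(1)] .
    have wl: "w \<in> lists (gens n)" using block_word_lists[OF L] us(2) by simp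
    have "w \<noteq> []"
      using us block_word_eq_Nil[of n us "last us"] by (auto simp: splits_iff)
    then have "braid_of n w \<noteq> \<one>\<^bsub>dual_braid_monoid n\<^esub>"
      using braid_of_eq_iff[OF wl, of "[]"] dual_eq_length[of n w "[]"]
      by (auto simp: one_dual_braid_monoid)
    moreover have "list_all2 (rotating_nf (n - 1)) (map (braid_of (n - 1)) (rev us)) (rev us)"
      using us(1) by (auto simp: splits_iff list_all2_map1 list.rel_refl_strong rotating_words_iff
          intro!: list.rel_refl_strong)
    ultimately have "rotating_nf n (braid_of n w) (rot_word n (rev us))"
      using us is_splitting_braid_of[OF L] braid_of_in_carrier[OF wl] assms
      by (intro rotating_nf.split) (auto simp: splits_iff)
    then show ?thesis using us(2) by (simp add: rotating_words_iff rot_word_rev)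
  qed
qed

text \<open>A last letter with index \<open>m\<close> cannot come from the first block, so that
  block is empty. The word is then the rotated product of the other blocks, whose tail is trivial:
  every pair contains \<open>m\<close>, and the last letter supplies one.\<close>

lemma single_chord_rotating_word:
  assumes m: "m \<ge> 3" and w: "w \<in> rotating_words m" "w \<noteq> []" "snd (last w) = m"
  shows "single_chord w (fst (last w)) m"
proof -
  have wl: "w \<in> lists (gens m)" using rotating_words_lists w(1) by blast
  obtain us where us: "splits m us" "w = block_word m us"
    using rotating_words_iff_splits[OF m] w(1,2) by auto
  obtain u us' where us': "us = u # us'" using us(1) by (cases us) auto
  have "u = []"
  proof (rule ccontr)
    assume u: "u \<noteq> []"
    then have "last w \<in> set u" using us(2) us' by simp
    moreover have "u \<in> lists (gens (m - 1))" using us us' rotating_words_lists by auto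
    ultimately show False using w(3) m by (auto simp: gens_def)
  qed
  then have tf: "tail_free m w" using us us' by (auto split: if_splits)
  have last: "alpha w (fst (last w)) (snd (last w))"
    using alpha_last[of "butlast w" "fst (last w)" "snd (last w)"] w(2) by simp
  have "last w \<in> gens m" using wl w(2) by (meson in_listsD last_in_set)
  show ?thesis
  proof (rule single_chord_if_star)
    show "alpha w (fst (last w)) m" using last w(3) by simp
    show "fst (last w) \<noteq> m" using \<open>last w \<in> gens m\<close> w(3) by (auto simp: gens_def)
    fix i j assume "alpha w i j" "i \<noteq> j"
    then show "i = m \<or> j = m"
      using tf equivp_symp[OF equivp_alpha, of w i j] unfolding tail_free_def
      by (metis linorder_neqE_nat)
  qed
qed

section \<open>Tail conditions as local conditions on consecutive blocks\<close>

definition has_barrier :: "nat \<Rightarrow> braid_word \<Rightarrow> bool" where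
  "has_barrier s w \<longleftrightarrow> (\<exists>(p, q) \<in> set w. p < s \<and> s < q)"

text \<open>In \<open>chain n (u # us)\<close> the number \<open>Suc t\<close>, with \<open>(t, n - 1)\<close> the last letter of the next
  block, is the point joined to \<open>n\<close> by the image of that letter under \<open>phi n\<close>.\<close>

fun chain :: "nat \<Rightarrow> braid_word list \<Rightarrow> bool" where
  "chain n [] \<longleftrightarrow> False"
| "chain n (u # us) \<longleftrightarrow> u \<in> rotating_words_star (n - 1) \<and> u \<noteq> [] \<and>
    (us \<noteq> [] \<longrightarrow> chain n us \<and>
      (let s = Suc (fst (last (hd us))) in s = n - 1 \<or> has_barrier s u))"

text \<open>The second block may be empty, in which case \<open>us\<close> starts with it and the third block is
  reached through \<open>a\<^bsub>1,n\<^esub>\<close>, the image of \<open>a\<^bsub>n-2,n-1\<^esub>\<close> under two rotations.\<close>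

definition skip_chain :: "nat \<Rightarrow> braid_word list \<Rightarrow> bool" where
  "skip_chain n us \<longleftrightarrow> (\<exists>us'. us = [] # us' \<and> chain n us' \<and> last (hd us') = (n - 2, n - 1))"

lemma rotating_words_star_iff:
  "u \<in> rotating_words_star m \<and> u \<noteq> [] \<longleftrightarrow> u \<in> rotating_words m \<and> u \<noteq> [] \<and> snd (last u) = m"
  by (cases "last u") (auto simp: rotating_words_star_def)

lemma chain_lists: "chain n us \<Longrightarrow> us \<in> lists (lists (gens (n - 1)))"
  by (induction us) (auto simp only: chain.simps rotating_words_star_def mem_Collect_eq
      lists.simps[of "_ # _"] intro!: rotating_words_lists lists.Nil)

lemma last_chain_block:
  assumes "chain n us"
  shows "last (hd us) = (fst (last (hd us)), n - 1)" "1 \<le> fst (last (hd us))"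
    "fst (last (hd us)) < n - 1"
proof -
  obtain u us' where us: "us = u # us'" using assms by (cases us) auto
  have u: "u \<in> rotating_words (n - 1)" "u \<noteq> []" "snd (last u) = n - 1"
    using assms rotating_words_star_iff[of u "n - 1"] by (auto simp: us)
  have "last u \<in> gens (n - 1)"
    using rotating_words_lists[OF u(1)] u(2) by (meson in_listsD last_in_set)
  then show "last (hd us) = (fst (last (hd us)), n - 1)" "1 \<le> fst (last (hd us))"
    "fst (last (hd us)) < n - 1"
    using u(3) by (auto simp: us gens_def prod_eq_iff)
qed

context
  fixes n :: nat
  assumes n: "n \<ge> 4"
begin

lemma single_chord_phi_block_word:
  assumes "chain n us" "single_chord (block_word n us) (fst (last (hd us))) (n - 1)"
  shows "single_chord (phi_word n (block_word n us)) (Suc (fst (last (hd us)))) n"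
proof -
  let ?t = "fst (last (hd us))"
  have t: "1 \<le> ?t" "?t < n - 1" by (rule last_chain_block[OF assms(1)])+
  then have "rotate_point n ?t = Suc ?t" "rotate_point n (n - 1) = n"
    using n by (auto simp: rotate_point_def)
  moreover have "?t \<in> {1..n}" "n - 1 \<in> {1..n}" "?t \<noteq> n - 1" using t n by auto
  ultimately show ?thesis
    using single_chord_phi_word[OF assms(2) block_word_lists[OF chain_lists[OF assms(1)]]] by metis
qed

lemma tail_free_phi_word_single_chord:
  assumes "single_chord w t (n - 1)" "w \<in> lists (gens n)"
  shows "tail_free n (phi_word n w)"
  using tail_free_phi_word[OF assms(2)] assms(1) n by (auto simp: single_chord_def)

text \<open>The single chord passes from one block to the next: rotation sends
  \<open>{t, n - 1}\<close> to \<open>{t + 1, n}\<close>, and the barrier condition with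
  \<open>s = t + 1\<close> is what \<open>single_chord_append\<close> requires.\<close>

lemma chain_single_chord:
  "chain n us \<Longrightarrow> single_chord (block_word n us) (fst (last (hd us))) (n - 1)"
proof (induction us)
  case (Cons u us)
  have u: "u \<in> rotating_words (n - 1)" "u \<noteq> []" "snd (last u) = n - 1"
    using Cons.prems rotating_words_star_iff[of u "n - 1"] by auto
  have chord: "single_chord u (fst (last u)) (n - 1)"
    using single_chord_rotating_word[of "n - 1" u] u n by auto
  show ?case
  proof (cases "us = []")
    case False
    then have us: "chain n us" using Cons.prems by simp
    note lst = last_chain_block[OF us]
    have "single_chord (phi_word n (block_word n us) @ u) (fst (last u)) (n - 1)"
    proof (rule single_chord_append[OF single_chord_phi_block_word[OF us Cons.IH[OF us]]])
      show "phi_word n (block_word n us) \<in> lists (gens n)"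
        by (intro phi_word_lists block_word_lists chain_lists us)
      show "u \<in> lists (gens (n - 1))" using u(1) by (rule rotating_words_lists)
      show "last u = (fst (last u), n - 1)" using u(3) by (simp add: prod_eq_iff)
      show "Suc (fst (last (hd us))) = n - 1 \<or>
          (\<exists>(p, q) \<in> set u. p < Suc (fst (last (hd us))) \<and> Suc (fst (last (hd us))) < q)"
        using Cons.prems False by (simp add: has_barrier_def Let_def)
    qed (use u chord lst n in auto)
    then show ?thesis by simp
  qed (use chord in simp)
qed simp

lemma chain_tail_free: "chain n us \<Longrightarrow> tail_free n (phi_word n (block_word n us))"
  by (rule tail_free_phi_word_single_chord[OF chain_single_chord block_word_lists[OF chain_lists]])

lemma chain_splits: "chain n us \<Longrightarrow> splits n us"
proof (induction us)
  case (Cons u us)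
  then show ?case
    using rotating_words_star_iff[of u "n - 1"] chain_tail_free[of us] by auto
qed simp

lemma skip_chain_single_chord:
  assumes "skip_chain n us"
  shows "single_chord (block_word n us) (n - 1) n"
proof -
  obtain us' where us': "us = [] # us'" "chain n us'" "last (hd us') = (n - 2, n - 1)"
    using assms by (auto simp: skip_chain_def)
  show ?thesis
    using single_chord_phi_block_word[OF us'(2) chain_single_chord[OF us'(2)]] us' n
    by (simp add: Suc_diff_Suc numeral_2_eq_2)
qed

lemma skip_chain_lists:
  assumes "skip_chain n us" shows "us \<in> lists (lists (gens (n - 1)))"
proof -
  obtain us' where "us = [] # us'" "chain n us'" using assms by (auto simp: skip_chain_def)
  then show ?thesis using chain_lists[of n us'] by simp
qed

lemma nil_rotating_word: "m \<ge> 2 \<Longrightarrow> [] \<in> rotating_words m"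
proof (cases "m = 2")
  case True
  then show ?thesis
    using rotating_nf.two[of "braid_of 2 []" 0] braid_of_in_carrier[of "[]" 2]
    by (auto simp: rotating_words_iff in_braid_of dual_eq.refl)
next
  case False
  assume "m \<ge> 2"
  then show ?thesis using False rotating_words_iff_splits[of m "[]"] by simp
qed

lemma skip_chain_splits:
  assumes "skip_chain n us"
  shows "splits n us" "tail_free n (phi_word n (block_word n us))"
proof -
  obtain us' where us': "us = [] # us'" "chain n us'" "last (hd us') = (n - 2, n - 1)"
    using assms by (auto simp: skip_chain_def)
  then show "splits n us"
    using chain_splits[of us'] chain_tail_free[of us'] nil_rotating_word[of "n - 1"] n by auto
  have bl: "block_word n us \<in> lists (gens n)"
    using block_word_lists skip_chain_lists assms by blast
  show "tail_free n (phi_word n (block_word n us))"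
    using tail_free_phi_word[OF bl] skip_chain_single_chord[OF assms] n by (auto simp: single_chord_def)
qed

text \<open>The barrier conditions are forced by \<open>barrier_if_no_other_chord\<close>. An empty
  block is possible once only and only in front: it leaves the pair \<open>{n - 1, n}\<close>, which
  the next rotation turns into \<open>{1, n}\<close>, and no block can remove that pair.\<close>

lemma chain_if_tail_free:
  assumes "splits n us" "tail_free n (phi_word n (block_word n us))"
  shows "chain n us \<or> skip_chain n us"
  using assms
proof (induction us)
  case (Cons u us)
  define w where "w = block_word n (u # us)"
  have wl: "w \<in> lists (gens n)"
    unfolding w_def by (intro block_word_lists splits_lists Cons.prems)
  have u: "u \<in> rotating_words (n - 1)" using Cons.prems(1) by simp
  have ul: "u \<in> lists (gens (n - 1))" using u by (rule rotating_words_lists)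
  have star: "i = n - 1 \<or> j = n - 1" if "alpha w i j" "i \<noteq> j" for i j
    using Cons.prems(2) tail_free_phi_word[OF wl] that n unfolding w_def by auto
  \<comment> \<open>The last letter of \<open>u\<close> right-divides the whole product, so it must
    contain \<open>n - 1\<close>.\<close>
  have chord: "snd (last u) = n - 1 \<and> single_chord u (fst (last u)) (n - 1)" if ne: "u \<noteq> []"
  proof -
    obtain p q where pq: "last u = (p, q)" by (meson surj_pair)
    have "w = (phi_word n (block_word n us) @ butlast u) @ [(p, q)]"
      using ne pq append_butlast_last_id[OF ne] by (simp add: w_def)
    then have "alpha w p q" using alpha_last by metis
    moreover have "(p, q) \<in> gens (n - 1)" using ul ne pq by (metis in_listsD last_in_set)
    ultimately have "q = n - 1" using star[of p q] by (auto simp: gens_def)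
    then show ?thesis using single_chord_rotating_word[of "n - 1" u] u ne n pq by auto
  qed
  show ?case
  proof (cases "us = []")
    case True
    then show ?thesis
      using Cons.prems(1) chord rotating_words_star_iff[of u "n - 1"] by auto
  next
    case False
    then have us: "splits n us" "tail_free n (phi_word n (block_word n us))"
      using Cons.prems(1) by auto
    define h where "h = phi_word n (block_word n us)"
    have hl: "h \<in> lists (gens n)"
      unfolding h_def by (intro phi_word_lists block_word_lists splits_lists us)
    have w: "w = h @ u" by (simp add: w_def h_def)
    have barrier: "s = n - 1 \<or> has_barrier s u"
      if "u \<noteq> []" "single_chord h s n" "1 \<le> s" "s < n" for s
      using barrier_if_no_other_chord[OF that(2) hl that(3,4) ul that(1), of "fst (last u)"]
        chord[OF that(1)] star unfolding w has_barrier_def by (metis prod.collapse)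
    from Cons.IH[OF us] show ?thesis
    proof
      assume c: "chain n us"
      let ?s = "Suc (fst (last (hd us)))"
      note lst = last_chain_block[OF c]
      have h: "single_chord h ?s n"
        unfolding h_def by (intro single_chord_phi_block_word chain_single_chord c)
      show ?thesis
      proof (cases "u = []")
        case True
        have "?s = n - 1"
        proof -
          have "alpha w ?s n" using h by (simp add: w True single_chord_def)
          moreover have "?s \<noteq> n" "n \<noteq> n - 1" using lst n by auto
          ultimately show ?thesis using star[of ?s n] by blast
        qed
        then have "last (hd us) = (n - 2, n - 1)" using lst by (auto simp: prod_eq_iff)
        then show ?thesis using True c by (auto simp: skip_chain_def)
      next
        case ne: False
        show ?thesis
          using barrier[OF ne h] lst ne chord[OF ne] c u rotating_words_star_iff[of u "n - 1"]
          by (auto simp: Let_def)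
      qed
    next
      assume c: "skip_chain n us"
      have "single_chord h n 1"
        using single_chord_phi_word[OF skip_chain_single_chord[OF c]
            block_word_lists[OF skip_chain_lists[OF c]]] n
        by (simp add: h_def rotate_point_def)
      then have h: "single_chord h 1 n" by (auto simp: single_chord_def)
      show ?thesis
      proof (cases "u = []")
        case True
        then show ?thesis using star[of 1 n] h n by (auto simp: w single_chord_def)
      next
        case ne: False
        \<comment> \<open>A barrier at \<open>1\<close> would need a letter starting below
          \<open>1\<close>; the alternative \<open>1 = n - 1\<close> fails as well.\<close>
        have "has_barrier 1 u" using barrier[OF ne h] n by auto
        then show ?thesis using ul by (auto simp: has_barrier_def gens_def)
      qed
    qed
  qed
qed simp

text \<open>The first block enters no tail condition and so ranges over all rotating words.\<close>

lemma splits_iff_chain: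
  "splits n (u # us) \<longleftrightarrow> u \<in> rotating_words (n - 1) \<and>
    (if us = [] then u \<noteq> [] else chain n us \<or> skip_chain n us)"
  using chain_if_tail_free[of us] chain_splits[of us] chain_tail_free[of us] skip_chain_splits[of us]
  by auto

lemma rotating_words_iff_chain:
  "w \<in> rotating_words n \<longleftrightarrow> (\<exists>u us. w = block_word n (u # us) \<and> u \<in> rotating_words (n - 1) \<and>
    (us = [] \<or> chain n us \<or> skip_chain n us))"
proof -
  have "w \<in> rotating_words n \<longleftrightarrow> w = [] \<or> (\<exists>u us. splits n (u # us) \<and> w = block_word n (u # us))"
  proof -
    have "(\<exists>us. splits n us \<and> w = block_word n us) \<longleftrightarrow>
        (\<exists>u us. splits n (u # us) \<and> w = block_word n (u # us))"
      by (metis list.exhaust splits.simps(1))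
    then show ?thesis using rotating_words_iff_splits[of n w] n by simp
  qed
  also have "\<dots> \<longleftrightarrow> (\<exists>u us. w = block_word n (u # us) \<and> u \<in> rotating_words (n - 1) \<and>
    (us = [] \<or> chain n us \<or> skip_chain n us))" (is "_ \<longleftrightarrow> ?R")
  proof
    assume "w = [] \<or> (\<exists>u us. splits n (u # us) \<and> w = block_word n (u # us))"
    then show ?R
    proof
      assume "w = []"
      then show ?R
        using nil_rotating_word[of "n - 1"] n by (intro exI[of _ "[]"]) auto
    qed (auto simp only: splits_iff_chain split: if_splits)
  next
    assume ?R
    then show "w = [] \<or> (\<exists>u us. splits n (u # us) \<and> w = block_word n (u # us))"
    proof -
      obtain u us where u: "w = block_word n (u # us)" "u \<in> rotating_words (n - 1)"
        "us = [] \<or> chain n us \<or> skip_chain n us"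
        using \<open>?R\<close> by blast
      then have "us = [] \<and> u = [] \<or> splits n (u # us)"
        unfolding splits_iff_chain by (cases "us = []") auto
      then show ?thesis
      proof
        assume "us = [] \<and> u = []"
        then show ?thesis using u(1) by simp
      next
        assume "splits n (u # us)"
        then show ?thesis using u(1) by blast
      qed
    qed
  qed
  finally show ?thesis .
qed

end

section \<open>Powers of the rotation\<close>

lemma rotate_point_range: "i \<in> {1..n} \<Longrightarrow> rotate_point n i \<in> {1..n}"
  by (auto simp: rotate_point_def)

lemma rotate_point_inject:
  "i \<in> {1..n} \<Longrightarrow> j \<in> {1..n} \<Longrightarrow> rotate_point n i = rotate_point n j \<longleftrightarrow> i = j"
  by (auto simp: rotate_point_def)

lemma phi_chord:
  assumes "i \<in> {1..n}" "j \<in> {1..n}" "i \<noteq> j"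
  shows "phi n (chord i j) = chord (rotate_point n i) (rotate_point n j)"
  using assms by (auto simp: chord_def rotate_point_def min_def max_def)

lemma funpow_rotate_point:
  assumes "i \<in> {1..n}"
  shows "(rotate_point n ^^ k) i = (i - 1 + k) mod n + 1"
proof (induction k)
  case (Suc k)
  have "(i - 1 + k) mod n < n" using assms by simp
  then show ?case
    using Suc by (auto simp: rotate_point_def mod_Suc)
qed (use assms in auto)

text \<open>On points the powers of the rotation are addition modulo \<open>n\<close>;
  \<open>chord\<close> hides the swap of endpoints when a letter wraps around.\<close>

lemma funpow_phi_chord:
  assumes "i \<in> {1..n}" "j \<in> {1..n}" "i \<noteq> j"
  shows "(phi n ^^ k) (chord i j) = chord ((rotate_point n ^^ k) i) ((rotate_point n ^^ k) j)"
proof -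
  have "(rotate_point n ^^ k) i \<in> {1..n} \<and> (rotate_point n ^^ k) j \<in> {1..n} \<and>
      (rotate_point n ^^ k) i \<noteq> (rotate_point n ^^ k) j \<and>
      (phi n ^^ k) (chord i j) = chord ((rotate_point n ^^ k) i) ((rotate_point n ^^ k) j)"
  proof (induction k)
    case (Suc k)
    then show ?case
      using phi_chord[of "(rotate_point n ^^ k) i" n "(rotate_point n ^^ k) j"]
        rotate_point_range[of "(rotate_point n ^^ k) i" n] rotate_point_range[of "(rotate_point n ^^ k) j" n]
        rotate_point_inject[of "(rotate_point n ^^ k) i" n "(rotate_point n ^^ k) j"]
      by simp
  qed (use assms in simp)
  then show ?thesis by blast
qed

lemma funpow_phi_n:
  assumes "x \<in> gens n" shows "(phi n ^^ n) x = x"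
proof -
  obtain p q where x: "x = (p, q)" "1 \<le> p" "p < q" "q \<le> n" using assms by (auto simp: gens_def)
  have "(rotate_point n ^^ n) i = i" if "i \<in> {1..n}" for i
    using that by (cases i) (simp_all add: funpow_rotate_point)
  moreover have "x = chord p q" using x by (simp add: chord_def)
  ultimately show ?thesis
    using x funpow_phi_chord[of p n q n] by simp
qed

lemma funpow_phi_gens: "x \<in> gens n \<Longrightarrow> (phi n ^^ k) x \<in> gens n"
  by (induction k) (simp_all add: phi_gens del: phi.simps)

lemma inj_on_funpow_phi:
  assumes "k \<le> n" shows "inj_on (phi n ^^ k) (gens n)"
proof (rule inj_on_inverseI)
  show "(phi n ^^ (n - k)) ((phi n ^^ k) x) = x" if "x \<in> gens n" for x
    using funpow_phi_n[OF that] assms by (simp add: funpow_add[symmetric, THEN fun_cong, simplified comp_def])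
qed

lemma inj_on_phi: "1 \<le> n \<Longrightarrow> inj_on (phi n) (gens n)"
  using inj_on_funpow_phi[of 1 n] by simp

lemma map_phi_eq_iff:
  assumes "1 \<le> n" "u \<in> lists (gens n)" "v \<in> lists (gens n)"
  shows "map (phi n) u = map (phi n) v \<longleftrightarrow> u = v"
  using assms by (intro inj_on_map_eq_map inj_on_subset[OF inj_on_phi]) auto

lemma unrotate_phi: "k \<le> n \<Longrightarrow> x \<in> gens n \<Longrightarrow> unrotate n k ((phi n ^^ k) x) = x"
  unfolding unrotate_def by (intro inv_into_f_f inj_on_funpow_phi)

lemma phi_preimage:
  assumes "1 \<le> n" "v \<in> lists (gens n)"
  obtains v' where "v' \<in> lists (gens n)" "v = map (phi n) v'"
proof
  let ?v = "map (phi n ^^ (n - 1)) v"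
  show "?v \<in> lists (gens n)" using assms(2) funpow_phi_gens by auto
  have "phi n ((phi n ^^ (n - 1)) x) = x" if "x \<in> gens n" for x
    using funpow_phi_n[OF that] assms(1) by (cases n) (auto simp del: phi.simps)
  then show "v = map (phi n) ?v"
    using assms(2) by (auto simp: in_lists_conv_set map_idI simp del: phi.simps intro!: map_idI[symmetric])
qed

section \<open>Runs\<close>

lemma run_None [simp]: "run \<mu> None w = None"
  by (induction w) auto

lemma run_append: "run \<mu> s (u @ v) = run \<mu> (run \<mu> s u) v"
  by (induction u arbitrary: s) auto

lemma rev_in_mirror: "rev w \<in> L \<longleftrightarrow> w \<in> mirror L"
  by (auto simp: mirror_def intro: image_eqI[of _ rev "rev w"])

lemma rev_block_word: "rev (block_word n (u # us)) = rev u @ map (phi n) (rev (block_word n us))"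
  by (simp add: phi_word_def rev_map)

lemma chain_first_letter:
  assumes "chain n us"
  obtains v where "rev (block_word n us) = last (hd us) # v"
proof -
  obtain u us' where us: "us = u # us'" "u \<noteq> []" using assms by (cases us) auto
  obtain w x where "u = w @ [x]" using us(2) by (metis append_butlast_last_id)
  then show thesis
    using that[of "rev w @ map (phi n) (rev (block_word n us'))"] us(1)
    by (simp add: rev_block_word del: block_word.simps)
qed

lemma rev_block_word_lists:
  "us \<in> lists (lists (gens (n - 1))) \<Longrightarrow> rev (block_word n us) \<in> lists (gens n)"
  using block_word_lists[of us n] by (simp add: in_lists_conv_set)

lemma gens_split:
  assumes "x \<in> gens n" "x \<notin> gens (n - 1)"
  obtains p where "x = (p, n)" "1 \<le> p" "p < n"
  using assms by (cases x) (auto simp: gens_def)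

lemma in_Union_bar: "(p, n) \<in> \<Union> (bar n ` set z) \<longleftrightarrow> has_barrier p z"
proof -
  have "(p, n) \<in> bar n x \<longleftrightarrow> fst x < p \<and> p < snd x" for x
    by (cases x) auto
  then show ?thesis by (simp add: has_barrier_def case_prod_beta)
qed

lemma level_trans_phi:
  assumes "k < n" "x \<in> gens (n - 1)"
  shows "next_trans n P (k, s, m) ((phi n ^^ k) x) =
    map_option (\<lambda>t. (k, t, m \<union> bar n x)) (ptrans P s x)"
proof -
  have "x \<in> gens n" using assms(2) gens_mono[of "n - 1" n] by auto
  then show ?thesis
    using assms by (simp add: next_trans_def level_trans_def unrotate_phi)
qed

lemma level_init_phi:
  assumes "k \<le> n" "x \<in> gens (n - 1)"
  shows "level_init n P k ((phi n ^^ k) x) =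
    map_option (\<lambda>t. (if k = n then 0 else k, t, bar n x)) (pinit P x)"
proof -
  have x: "x \<in> gens n" using assms(2) gens_mono[of "n - 1" n] by auto
  show ?thesis
  proof (cases "k = n")
    case True
    then show ?thesis
      using funpow_phi_n[OF x] unrotate_phi[of 0 n x] x by (simp add: level_init_def)
  next
    case False
    then show ?thesis using unrotate_phi[OF assms(1) x] by (simp add: level_init_def)
  qed
qed

text \<open>In the coordinates of the current block, \<open>(p, n)\<close> is the rotated last
  letter of the next block, and \<open>p\<close> is the point joined to \<open>n\<close>. The test
  of the automaton is thus the condition in \<open>chain\<close>.\<close>

lemma next_trans_phi:
  assumes "n \<ge> 4" "k < n" "1 \<le> p" "p < n" "z \<in> lists (gens (n - 1))"
  shows "next_trans n P (k, s, \<Union> (bar n ` set z)) ((phi n ^^ k) (p, n)) =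
    (if p = n - 1 \<or> has_barrier p z then level_init n P (k + 1) ((phi n ^^ k) (p, n)) else None)"
proof -
  have x: "(p, n) \<in> gens n" "(p, n) \<notin> gens (n - 1)" using assms by (auto simp: gens_def)
  \<comment> \<open>A barrier at \<open>p\<close> already forces the range to which
    \<open>next_trans\<close> restricts the membership test.\<close>
  have "2 \<le> p \<and> p \<le> n - 2" if "has_barrier p z"
    using that assms(5) by (fastforce simp: has_barrier_def gens_def in_lists_conv_set)
  moreover have "unrotate n k ((phi n ^^ k) (p, n)) = (p, n)"
    using unrotate_phi[OF _ x(1), of k] assms(2) by simp
  ultimately show ?thesis
    unfolding next_trans_def prod.case Let_def by (simp only: in_Union_bar x(2) if_False) auto
qed

lemma phi_last_chain_block:
  assumes "n \<ge> 2" "chain n us"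
  shows "phi n (last (hd us)) = (Suc (fst (last (hd us))), n)"
  by (subst last_chain_block(1)[OF assms(2)]) (use assms(1) in simp)

text \<open>The word \<open>z\<close> is the part of the current block that the automaton has already read, hence
  reversed, and \<open>v\<close> is what is left, rotated back to the coordinates of that block.\<close>

definition continues :: "nat \<Rightarrow> braid_word \<Rightarrow> braid_word \<Rightarrow> bool" where
  "continues n z v \<longleftrightarrow>
    (\<exists>y us. chain n (rev (z @ y) # us) \<and> v = y @ map (phi n) (rev (block_word n us)))"

lemma continuesI:
  "chain n (rev (z @ y) # us) \<Longrightarrow> v = y @ map (phi n) (rev (block_word n us)) \<Longrightarrow> continues n z v"
  unfolding continues_def by blast

lemma continuesE:
  assumes "continues n z v"
  obtains y us where "chain n (rev (z @ y) # us)" "v = y @ map (phi n) (rev (block_word n us))"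
  using assms unfolding continues_def by blast

lemma chain_Cons_lists: "chain n (rev (z @ y) # us) \<Longrightarrow> y \<in> lists (gens (n - 1))"
  using chain_lists[of n "rev (z @ y) # us"] by (simp add: in_lists_conv_set)

lemma chain_first_block:
  "(\<exists>us. chain n us \<and> x # v = rev (block_word n us)) \<longleftrightarrow> continues n [x] v"
proof
  assume "\<exists>us. chain n us \<and> x # v = rev (block_word n us)"
  then obtain us where us: "chain n us" "x # v = rev (block_word n us)" by blast
  then obtain u us' where u: "us = u # us'" "u \<noteq> []" by (cases us) auto
  have "x # v = rev u @ map (phi n) (rev (block_word n us'))"
    using us(2) unfolding u rev_block_word .
  moreover from this obtain y where y: "rev u = x # y"
    using u(2) by (cases "rev u") auto
  moreover from y have "u = rev ([x] @ y)" by (metis append_Cons append_Nil rev_rev_ident)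
  ultimately show "continues n [x] v"
    using us(1) u(1) by (intro continuesI[of n "[x]" y us']) auto
next
  assume "continues n [x] v"
  then obtain y us where "chain n (rev ([x] @ y) # us)"
    "v = y @ map (phi n) (rev (block_word n us))" by (rule continuesE)
  moreover from this have "rev (block_word n (rev ([x] @ y) # us)) = x # v"
    unfolding rev_block_word by simp
  ultimately show "\<exists>us. chain n us \<and> x # v = rev (block_word n us)" by metis
qed

section \<open>Correctness of the transitions of the new partial automaton\<close>

context
  fixes n :: nat and P :: "('t, letter) partial_automaton"
  assumes n: "n \<ge> 4"
    and palphabet: "palphabet P = gens (n - 1)"
    and recog: "partial_recognizes P (mirror (rotating_words_star (n - 1)))"
begin

definition prun :: "braid_word \<Rightarrow> 't closure_state option" where
  "prun z = run (automaton.trans (closure P)) (Some Start) z"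

lemma star_iff_prun:
  "rev z \<in> rotating_words_star (n - 1) \<longleftrightarrow> z \<in> lists (gens (n - 1)) \<and> prun z \<noteq> None"
  using recog unfolding rev_in_mirror partial_recognizes_def recognizes_def
  by (auto simp: prun_def closure_def palphabet)

lemma prun_singleton: "prun [x] = map_option Old (pinit P x)"
  by (simp add: prun_def closure_def)

lemma prun_snoc: "prun z = Some (Old s) \<Longrightarrow> prun (z @ [x]) = map_option Old (ptrans P s x)"
  by (simp add: prun_def run_append closure_def)

text \<open>Every live state accepts, so the recognized language is prefix-closed: once
  \<open>P\<close> is dead, no completion of the current block helps.\<close>

lemma prun_prefix: "prun (z @ y) \<noteq> None \<Longrightarrow> prun z \<noteq> None"
  unfolding prun_def run_append by (metis run_None)

text \<open>The correctness of runs inside a block is the hypothesis \<open>level\<close>, so that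
  this lemma serves both within the induction of \<open>run_next_trans\<close>, fed with its
  induction hypothesis, and after it.\<close>

lemma run_level_init:
  assumes k: "1 \<le> k" "k \<le> n" and x: "x \<in> gens (n - 1)" and v: "v \<in> lists (gens n)"
    and level: "\<And>l s. l < n \<Longrightarrow> prun [x] = Some (Old s) \<Longrightarrow>
      run (next_trans n P) (Some (l, s, bar n x)) (map (phi n ^^ l) v) \<noteq> None \<longleftrightarrow> continues n [x] v"
  shows "run (next_trans n P) (level_init n P k ((phi n ^^ k) x)) (map (phi n ^^ k) v) \<noteq> None \<longleftrightarrow>
    (\<exists>us. chain n us \<and> x # v = rev (block_word n us))"
proof (cases "pinit P x")
  case None
  have "\<not> continues n [x] v"
  proof
    assume "continues n [x] v"
    then obtain y where "rev ([x] @ y) \<in> rotating_words_star (n - 1)" unfolding continues_def chain.simps by blast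
    then have "prun [x] \<noteq> None"
      unfolding star_iff_prun using prun_prefix by blast
    then show False using None by (simp add: prun_singleton)
  qed
  then show ?thesis
    unfolding chain_first_block level_init_phi[OF k(2) x] None by simp
next
  case (Some s)
  \<comment> \<open>At \<open>k = n\<close> the level wraps to 0, and the remaining word keeps its
    coordinates because \<open>n\<close> rotations fix every letter.\<close>
  let ?l = "if k = n then 0 else k"
  have "?l < n" using k n by auto
  have "map (phi n ^^ k) v = map (phi n ^^ ?l) v"
    using v funpow_phi_n by (auto simp: in_lists_conv_set)
  moreover have "level_init n P k ((phi n ^^ k) x) = Some (?l, s, bar n x)"
    using level_init_phi[OF k(2) x, of P] Some by simp
  ultimately show ?thesis
    unfolding chain_first_block using level[OF \<open>?l < n\<close>, of s] Some
    by (simp only: prun_singleton option.map)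
qed

text \<open>The level, the state of \<open>P\<close> and the part already read vary in the
  induction: a new block raises the level, restarts \<open>P\<close> and empties the record of
  barriers. Length is the measure because \<open>v\<close> is also replaced by a rotated preimage of
  its rest.\<close>

lemma run_next_trans:
  assumes "k < n" "z \<noteq> []" "z \<in> lists (gens (n - 1))" "prun z = Some (Old s)" "v \<in> lists (gens n)"
  shows "run (next_trans n P) (Some (k, s, \<Union> (bar n ` set z))) (map (phi n ^^ k) v) \<noteq> None \<longleftrightarrow>
    continues n z v"
  using assms
proof (induction "length v" arbitrary: k z s v rule: less_induct)
  case less
  show ?case
  proof (cases v)
    case Nil
    have "chain n [rev z]" using less.prems star_iff_prun[of z] by simp
    then have "continues n z v" using Nil by (intro continuesI[of n z "[]" "[]"]) auto
    then show ?thesis using Nil by simp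
  next
    case (Cons x v')
    have x: "x \<in> gens n" "v' \<in> lists (gens n)" using less.prems(5) Cons by auto
    show ?thesis
    proof (cases "x \<in> gens (n - 1)")
      case True
      \<comment> \<open>A letter of \<open>gens (n - 1)\<close> cannot open the next block, whose
        first letter has index \<open>n\<close> in these coordinates; so it prolongs the current
        one.\<close>
      have ex: "continues n z v \<longleftrightarrow> continues n (z @ [x]) v'"
      proof
        assume "continues n (z @ [x]) v'"
        then obtain y us where "chain n (rev ((z @ [x]) @ y) # us)"
          "v' = y @ map (phi n) (rev (block_word n us))" by (rule continuesE)
        then show "continues n z v" unfolding Cons by (intro continuesI[of n z "x # y" us]) simp_all
      next
        assume "continues n z v"
        then obtain y us where y: "chain n (rev (z @ y) # us)"
          "v = y @ map (phi n) (rev (block_word n us))" by (rule continuesE)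
        show "continues n (z @ [x]) v'"
        proof (cases y)
          case Nil
          then have "us \<noteq> []" using y(2) Cons by auto
          then have us: "chain n us" using y(1) by simp
          then have "x = phi n (last (hd us))"
            using chain_first_letter[OF us] y(2) Nil Cons by (metis append_Nil list.inject list.simps(9))
          then have "x = (Suc (fst (last (hd us))), n)" using phi_last_chain_block[OF _ us] n by simp
          then show ?thesis using True n by (auto simp: gens_def)
        next
          case (Cons x' y')
          then show ?thesis using y \<open>v = x # v'\<close> by (intro continuesI[of n _ y' us]) simp_all
        qed
      qed
      show ?thesis
      proof (cases "ptrans P s x")
        case None
        have "prun (z @ [x]) = None" using None prun_snoc[OF less.prems(4)] by simp
        then have "rev ((z @ [x]) @ y) \<notin> rotating_words_star (n - 1)" for y
          unfolding star_iff_prun using prun_prefix by blast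
        then have "\<not> continues n (z @ [x]) v'" unfolding continues_def chain.simps by blast
        then show ?thesis
          unfolding ex unfolding Cons
          using None level_trans_phi[OF less.prems(1) True, of P s] by simp
      next
        case (Some s')
        have "prun (z @ [x]) = Some (Old s')" using Some prun_snoc[OF less.prems(4)] by simp
        then have "run (next_trans n P) (Some (k, s', \<Union> (bar n ` set (z @ [x])))) (map (phi n ^^ k) v')
            \<noteq> None \<longleftrightarrow> continues n (z @ [x]) v'"
          using less.prems less.hyps[of v' k "z @ [x]" s'] x True Cons by simp
        then show ?thesis
          unfolding ex unfolding Cons
          using Some level_trans_phi[OF less.prems(1) True, of P s] by (simp add: Un_commute)
      qed
    next
      case False
      obtain p where p: "x = (p, n)" "1 \<le> p" "p < n" by (rule gens_split[OF x(1) False])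
      let ?ok = "p = n - 1 \<or> has_barrier p z"
      obtain v'' where v'': "v'' \<in> lists (gens n)" "v' = map (phi n) v''"
        using phi_preimage[OF _ x(2)] n by auto
      \<comment> \<open>A letter with index \<open>n\<close> cannot belong to the current block, so
        that block is complete and equals \<open>rev z\<close>.\<close>
      have ex: "continues n z v \<longleftrightarrow>
          (\<exists>us. us \<noteq> [] \<and> chain n (rev z # us) \<and> v = map (phi n) (rev (block_word n us)))"
      proof
        assume "continues n z v"
        then obtain y us where y: "chain n (rev (z @ y) # us)"
          "v = y @ map (phi n) (rev (block_word n us))" by (rule continuesE)
        have "y = []"
          using chain_Cons_lists[OF y(1)] y(2) Cons False by (cases y) auto
        moreover from this have "us \<noteq> []" using y(2) Cons by auto
        ultimately show "\<exists>us. us \<noteq> [] \<and> chain n (rev z # us) \<and> v = map (phi n) (rev (block_word n us))"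
          using y by auto
      next
        assume "\<exists>us. us \<noteq> [] \<and> chain n (rev z # us) \<and> v = map (phi n) (rev (block_word n us))"
        then show "continues n z v" by (auto intro!: continuesI[of n z "[]"])
      qed
      show ?thesis
      proof (cases ?ok)
        case ok: True
        have "p \<noteq> 1" using ok n less.prems(3)
          by (auto simp: has_barrier_def in_lists_conv_set gens_def)
        \<comment> \<open>This is the letter in the coordinates of the next block, where it is the
          last letter of that block; \<open>p\<close> is one more than its first index.\<close>
        define x' where "x' = (p - 1, n - 1)"
        have x': "x' \<in> gens (n - 1)" "phi n x' = x" "x' \<in> gens n"
          using p \<open>p \<noteq> 1\<close> n by (auto simp: x'_def gens_def)
        have v: "v = map (phi n) (x' # v'')" using Cons v'' x' by simp
        have "continues n z v \<longleftrightarrow> (\<exists>us. chain n us \<and> x' # v'' = rev (block_word n us))"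
        proof
          assume "continues n z v"
          then obtain us where us: "us \<noteq> []" "chain n (rev z # us)"
            "v = map (phi n) (rev (block_word n us))" unfolding ex by blast
          then have "chain n us" by simp
          then have "x' # v'' = rev (block_word n us)"
            using us(3) v map_phi_eq_iff[of n "x' # v''" "rev (block_word n us)"] x' v'' n
              rev_block_word_lists[OF chain_lists, of n us] by (simp del: phi.simps)
          then show "\<exists>us. chain n us \<and> x' # v'' = rev (block_word n us)" using \<open>chain n us\<close> by blast
        next
          assume "\<exists>us. chain n us \<and> x' # v'' = rev (block_word n us)"
          then obtain us where us: "chain n us" "x' # v'' = rev (block_word n us)" by blast
          have "x' = last (hd us)" using chain_first_letter[OF us(1)] us(2) by (metis list.inject)
          then have "Suc (fst (last (hd us))) = p" using p(2) \<open>p \<noteq> 1\<close> \<open>x' = last (hd us)\<close>[symmetric] by (simp add: x'_def)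
          moreover have "us \<noteq> []" using us(1) by auto
          moreover have "rev z \<in> rotating_words_star (n - 1)"
            using less.prems star_iff_prun by blast
          ultimately have "chain n (rev z # us)"
            using us(1) ok less.prems(2) by (auto simp: Let_def has_barrier_def)
          then show "continues n z v"
            unfolding ex using us \<open>us \<noteq> []\<close> v by metis
        qed
        also have "\<dots> \<longleftrightarrow> run (next_trans n P) (level_init n P (k + 1) ((phi n ^^ (k + 1)) x'))
            (map (phi n ^^ (k + 1)) v'') \<noteq> None"
        proof (rule run_level_init[symmetric])
          show "run (next_trans n P) (Some (l, s, bar n x')) (map (phi n ^^ l) v'') \<noteq> None \<longleftrightarrow>
              continues n [x'] v''" if "l < n" "prun [x'] = Some (Old s)" for l s
            using less.hyps[of v'' l "[x']" s] that x' v'' Cons by simp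
        qed (use less.prems x' v'' in auto)
        also have "(phi n ^^ (k + 1)) x' = (phi n ^^ k) x"
          using x' by (simp add: funpow_swap1 del: phi.simps)
        also have "map (phi n ^^ (k + 1)) v'' = map (phi n ^^ k) v'"
          using v'' by (simp add: funpow_swap1 comp_def del: phi.simps)
        finally show ?thesis
          using next_trans_phi[OF n less.prems(1) p(2,3) less.prems(3), of P s] ok unfolding Cons p(1) by simp
      next
        case notok: False
        have "\<not> continues n z v"
        proof
          assume "continues n z v"
          then obtain us where us: "us \<noteq> []" "chain n (rev z # us)"
            "v = map (phi n) (rev (block_word n us))" unfolding ex by blast
          then have "chain n us" by simp
          have "x = phi n (last (hd us))"
            using chain_first_letter[OF \<open>chain n us\<close>] us(3) Cons by (metis list.inject list.simps(9))
          then have "p = Suc (fst (last (hd us)))"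
            using phi_last_chain_block[OF _ \<open>chain n us\<close>] p n by simp
          then show False using us(1,2) notok by (auto simp: Let_def has_barrier_def)
        qed
        then show ?thesis
          using next_trans_phi[OF n less.prems(1) p(2,3) less.prems(3), of P s] notok unfolding Cons p(1) by simp
      qed
    qed
  qed
qed

lemma run_level:
  assumes "1 \<le> k" "k \<le> n" "x \<in> gens (n - 1)" "v \<in> lists (gens n)"
  shows "run (next_trans n P) (level_init n P k ((phi n ^^ k) x)) (map (phi n ^^ k) v) \<noteq> None \<longleftrightarrow>
    (\<exists>us. chain n us \<and> x # v = rev (block_word n us))"
  using assms run_next_trans[of _ "[x]"] by (intro run_level_init) simp_all

text \<open>The opening letter tells the two shapes apart. A chain opens with
  \<open>(t + 1, n)\<close>, where \<open>t + 1\<close> is at least 2, and starts on level 1; an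
  empty second block shows as \<open>(1, n)\<close> and starts on level 2. No barrier is tested
  here, as the first block is unconstrained.\<close>

lemma run_next_init:
  assumes v: "v \<in> lists (gens n)" and x: "x \<in> gens n" "x \<notin> gens (n - 1)"
  shows "run (next_trans n P) (next_init n P x) v \<noteq> None \<longleftrightarrow>
    (\<exists>us. (chain n us \<or> skip_chain n us) \<and> x # v = map (phi n) (rev (block_word n us)))"
proof -
  obtain p where p: "x = (p, n)" "1 \<le> p" "p < n" by (rule gens_split[OF x])
  obtain v' where v': "v' \<in> lists (gens n)" "v = map (phi n) v'"
    using phi_preimage[OF _ v] n by auto
  have first: "p = Suc (fst (last (hd us)))" "1 \<le> fst (last (hd us))"
    if "chain n us" "x # v = map (phi n) (rev (block_word n us))" for us
  proof -
    have "x = phi n (last (hd us))"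
      using chain_first_letter[OF that(1)] that(2) by (metis list.inject list.simps(9))
    then show "p = Suc (fst (last (hd us)))" "1 \<le> fst (last (hd us))"
      using phi_last_chain_block[OF _ that(1)] last_chain_block(2)[OF that(1)] p n by auto
  qed
  have first_skip: "p = 1"
    if us: "chain n us" "last (hd us) = (n - 2, n - 1)"
      "x # v = map (phi n) (rev (block_word n ([] # us)))" for us
  proof -
    obtain w where "rev (block_word n us) = last (hd us) # w"
      by (rule chain_first_letter[OF us(1)])
    then have "x = phi n (phi n (last (hd us)))"
      using us(3) unfolding rev_block_word by (simp del: phi.simps)
    then show ?thesis using p us(2) n by simp
  qed
  show ?thesis
  proof (cases "p = 1")
    case False
    define x' where "x' = (p - 1, n - 1)"
    have x': "x' \<in> gens (n - 1)" "phi n x' = x" "x' \<in> gens n"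
      using p False n by (auto simp: x'_def gens_def)
    have "(\<exists>us. (chain n us \<or> skip_chain n us) \<and> x # v = map (phi n) (rev (block_word n us))) \<longleftrightarrow>
        (\<exists>us. chain n us \<and> x # v = map (phi n) (rev (block_word n us)))"
    proof -
      have "\<not> skip_chain n us" if "x # v = map (phi n) (rev (block_word n us))" for us
      proof
        assume "skip_chain n us"
        then obtain us' where us': "us = [] # us'" "chain n us'" "last (hd us') = (n - 2, n - 1)"
          unfolding skip_chain_def by (elim exE conjE)
        then show False using first_skip[OF us'(2,3)] that False unfolding us'(1) by blast
      qed
      then show ?thesis by metis
    qed
    also have "\<dots> \<longleftrightarrow> (\<exists>us. chain n us \<and> x' # v' = rev (block_word n us))"
    proof -
      have "x # v = map (phi n) (rev (block_word n us)) \<longleftrightarrow> x' # v' = rev (block_word n us)"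
        if "chain n us" for us
        using map_phi_eq_iff[of n "x' # v'" "rev (block_word n us)"] x' v' n
          rev_block_word_lists[OF chain_lists[OF that]] by (simp del: phi.simps)
      then show ?thesis by (simp cong: conj_cong del: phi.simps)
    qed
    also have "\<dots> \<longleftrightarrow> run (next_trans n P) (next_init n P x) v \<noteq> None"
    proof -
      have "next_init n P x = level_init n P 1 x" using p False by (auto simp: next_init_def)
      then show ?thesis using run_level[of 1 x' v'] x' v' n by (simp del: phi.simps)
    qed
    finally show ?thesis by simp
  next
    case True
    \<comment> \<open>Two rotations are undone: one for the block that the automaton leaves, one for
      the empty block.\<close>
    define x' where "x' = (n - 2, n - 1)"
    have x': "x' \<in> gens (n - 1)" "phi n (phi n x') = x" "x' \<in> gens n"
      using p True n by (auto simp: x'_def gens_def)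
    obtain v'' where v'': "v'' \<in> lists (gens n)" "v' = map (phi n) v''"
      using phi_preimage[OF _ v'(1)] n by auto
    have "(\<exists>us. (chain n us \<or> skip_chain n us) \<and> x # v = map (phi n) (rev (block_word n us))) \<longleftrightarrow>
        (\<exists>us. chain n us \<and> last (hd us) = x' \<and> x # v = map (phi n) (rev (block_word n ([] # us))))"
    proof -
      have "\<not> chain n us" if "x # v = map (phi n) (rev (block_word n us))" for us
        using first[OF _ that] True by auto
      then have "(chain n us \<or> skip_chain n us) \<and> x # v = map (phi n) (rev (block_word n us)) \<longleftrightarrow>
          (\<exists>us'. us = [] # us' \<and> chain n us' \<and> last (hd us') = x' \<and>
            x # v = map (phi n) (rev (block_word n ([] # us'))))" for us
        unfolding skip_chain_def x'_def by metis
      then show ?thesis by metis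
    qed
    also have "\<dots> \<longleftrightarrow> (\<exists>us. chain n us \<and> x' # v'' = rev (block_word n us))"
    proof -
      have a: "x # v = map (phi n) (rev (block_word n ([] # us))) \<longleftrightarrow> x' # v'' = rev (block_word n us)"
        if "chain n us" for us
      proof -
        have L: "rev (block_word n us) \<in> lists (gens n)" "map (phi n) (rev (block_word n us)) \<in> lists (gens n)"
          using rev_block_word_lists[OF chain_lists[OF that]] phi_word_lists[of "rev (block_word n us)" n]
          by (simp_all only: phi_word_def)
        have L': "x' # v'' \<in> lists (gens n)" "map (phi n) (x' # v'') \<in> lists (gens n)"
          using x'(3) v''(1) phi_word_lists[of "x' # v''" n] by (simp_all only: phi_word_def lists.Cons)
        have "x # v = map (phi n) (map (phi n) (x' # v''))" using x' v' v'' by simp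
        then show ?thesis
          unfolding rev_block_word
          using map_phi_eq_iff[OF _ L'(2) L(2)] map_phi_eq_iff[OF _ L'(1) L(1)] n by simp
      qed
      have b: "last (hd us) = x'" if us: "chain n us" "x' # v'' = rev (block_word n us)" for us
      proof -
        obtain w where "rev (block_word n us) = last (hd us) # w"
          by (rule chain_first_letter[OF us(1)])
        then show ?thesis using us(2) by simp
      qed
      have "chain n us \<and> last (hd us) = x' \<and> x # v = map (phi n) (rev (block_word n ([] # us))) \<longleftrightarrow>
          chain n us \<and> x' # v'' = rev (block_word n us)" for us
        using a[of us] b[of us] by argo
      then show ?thesis by (simp only:)
    qed
    also have "\<dots> \<longleftrightarrow> run (next_trans n P) (level_init n P 2 ((phi n ^^ 2) x')) (map (phi n ^^ 2) v'') \<noteq> None"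
      using run_level[of 2 x' v''] x' v'' n by simp
    also have "(phi n ^^ 2) x' = x" using x' by (simp add: numeral_2_eq_2 del: phi.simps)
    also have "map (phi n ^^ 2) v'' = v" using v' v'' by (simp add: numeral_2_eq_2)
    also have "level_init n P 2 x = next_init n P x" using p True n by (simp add: next_init_def)
    finally show ?thesis by simp
  qed
qed

end

section \<open>Finiteness and closure of the state sets\<close>

lemma is_automaton_extend:
  assumes "is_automaton M" "alphabet M = gens (n - 1)" "is_partial_automaton Q" "palphabet Q = gens n"
  shows "is_automaton (extend_automaton n M Q)"
proof -
  have M: "trans M s x \<in> Some ` states M \<union> {None}" if "s \<in> states M" "x \<in> gens (n - 1)" for s x
    using assms(1,2) that by (simp add: is_automaton_def)
  have I: "pinit Q x \<in> Some ` pstates Q \<union> {None}" if "x \<in> gens n" for x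
    using assms(3,4) that by (simp add: is_partial_automaton_def)
  have T: "ptrans Q s x \<in> Some ` pstates Q \<union> {None}" if "s \<in> pstates Q" "x \<in> gens n" for s x
    using assms(3,4) that by (simp add: is_partial_automaton_def)
  have "finite (states M <+> pstates Q)" "Inl (init M) \<in> states M <+> pstates Q"
    using assms(1,3) by (auto simp: is_automaton_def is_partial_automaton_def)
  moreover have "trans (extend_automaton n M Q) s x \<in> Some ` (states M <+> pstates Q) \<union> {None}"
    if "s \<in> states M <+> pstates Q" "x \<in> gens n" for s x
    using that(1) M[of _ x] I[OF that(2)] T[OF _ that(2)]
    by (fastforce simp: extend_automaton_def split: sum.splits)
  ultimately show ?thesis
    by (simp add: is_automaton_def extend_automaton_def)
qed

lemma is_partial_automaton_next:
  assumes n: "n \<ge> 4" and P: "is_partial_automaton P" "palphabet P = gens (n - 1)"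
  shows "is_partial_automaton (next_partial n P)"
proof -
  let ?S = "\<Union>k \<in> {0..<n}. next_states n P k"
  let ?B = "{(p, n) | p. 2 \<le> p \<and> p \<le> n - 2}"
  have fin: "finite ?B" by (rule finite_subset[of _ "{..n} \<times> {n}"]) auto
  have bar: "bar n x \<subseteq> ?B" if "x \<in> gens (n - 1)" for x
    using that n by (cases x) (auto simp: gens_def)
  have li: "level_init n P k ((phi n ^^ k) x) \<in> Some ` ?S \<union> {None}"
    if "1 \<le> k" "k \<le> n" "x \<in> gens (n - 1)" for k x
  proof (cases "pinit P x")
    case None
    then show ?thesis using level_init_phi[OF that(2,3), of P] by simp
  next
    case (Some t)
    then have "t \<in> pstates P" using P that(3) by (fastforce simp: is_partial_automaton_def)
    then have "(if k = n then 0 else k, t, bar n x) \<in> ?S"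
      using that n bar[OF that(3)] by (auto simp: next_states_def)
    then show ?thesis using level_init_phi[OF that(2,3), of P] Some by auto
  qed
  have pred: "\<exists>x' \<in> gens (n - 1). phi n x' = (p, n)" if "2 \<le> p" "p \<le> n - 1" for p
    using that n by (intro bexI[of _ "(p - 1, n - 1)"]) (auto simp: gens_def)
  have init: "next_init n P x \<in> Some ` ?S \<union> {None}" if "x \<in> gens n" for x
  proof -
    obtain p q where x: "x = (p, q)" by (meson surj_pair)
    consider "q = n" "2 \<le> p" "p \<le> n - 1" | "q = n" "p = 1" | "next_init n P x = None"
      unfolding next_init_def x prod.case by (meson option.distinct(1))
    then show ?thesis
    proof cases
      case 1
      then obtain x' where "x' \<in> gens (n - 1)" "phi n x' = x" using pred x by blast
      then show ?thesis using li[of 1 x'] n 1 by (simp add: next_init_def x del: phi.simps)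
    next
      case 2
      have "(phi n ^^ 2) (n - 2, n - 1) = x" using n 2 by (simp add: x numeral_2_eq_2)
      moreover have "(n - 2, n - 1) \<in> gens (n - 1)" using n by (auto simp: gens_def)
      ultimately show ?thesis
        using li[of 2 "(n - 2, n - 1)"] n 2 by (simp add: next_init_def x del: phi.simps)
    qed simp
  qed
  have tr: "next_trans n P st y \<in> Some ` ?S \<union> {None}" if st_in: "st \<in> ?S" and y_in: "y \<in> gens n" for st y
  proof -
    obtain k s m where st: "st = (k, s, m)" "k < n" "s \<in> pstates P" "m \<subseteq> ?B"
      using st_in by (auto simp: next_states_def)
    define x where "x = (phi n ^^ (n - k)) y"
    have x: "x \<in> gens n" unfolding x_def using y_in by (rule funpow_phi_gens)
    have "(phi n ^^ k) x = (phi n ^^ (k + (n - k))) y" by (simp add: x_def funpow_add)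
    then have y: "y = (phi n ^^ k) x" using funpow_phi_n[OF y_in] st(2) by simp
    have un: "unrotate n k y = x" using unrotate_phi[OF _ x] st(2) y by simp
    show ?thesis
    proof (cases "x \<in> gens (n - 1)")
      case True
      show ?thesis
      proof (cases "ptrans P s x")
        case None
        then show ?thesis unfolding y st(1) level_trans_phi[OF st(2) True] by simp
      next
        case (Some t)
        then have "t \<in> pstates P" using P True st(3) by (fastforce simp: is_partial_automaton_def)
        then have "(k, t, m \<union> bar n x) \<in> ?S"
          using st(2,4) bar[OF True] by (auto simp: next_states_def)
        then show ?thesis unfolding y st(1) level_trans_phi[OF st(2) True] using Some by simp
      qed
    next
      case False
      show ?thesis
      proof (cases "next_trans n P st y = None")
        case ne: False
        obtain p where p: "x = (p, n)" "1 \<le> p" "p < n" by (rule gens_split[OF x False])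
        have "next_trans n P st y = level_init n P (k + 1) y \<and> 2 \<le> p \<and> p \<le> n - 1"
          using ne False p n unfolding next_trans_def st(1) prod.case un Let_def
          by (auto split: if_splits)
        moreover from this obtain x' where "x' \<in> gens (n - 1)" "phi n x' = x" using pred p by blast
        moreover from this have "(phi n ^^ (k + 1)) x' = y"
          using y by (simp add: funpow_swap1 del: phi.simps)
        ultimately show ?thesis using li[of "k + 1" x'] st(2) by simp
      qed simp
    qed
  qed
  have "finite ?S" using P(1) fin by (simp add: next_states_def is_partial_automaton_def)
  then show ?thesis
    unfolding is_partial_automaton_def next_partial_def partial_automaton.simps
    by (intro conjI ballI init tr)
qed

text \<open>Once in the new states the automaton never returns to those of \<open>M\<close>.\<close>

lemma run_extend_Inr:
  "run (trans (extend_automaton n M Q)) (map_option Inr st) w = map_option Inr (run (ptrans Q) st w)"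
proof (induction w arbitrary: st)
  case (Cons x w)
  show ?case
  proof (cases st)
    case (Some u)
    then show ?thesis using Cons.IH[of "ptrans Q u x"] by (simp add: extend_automaton_def)
  qed simp
qed simp

text \<open>The states of \<open>M\<close> process the first block \<open>rev (z @ y)\<close>, of
  which \<open>z\<close> has been read; leaving them means that this block is finished.\<close>

lemma run_extend_Inl:
  fixes n :: nat and M :: "('s, letter) automaton" and P :: "('t, letter) partial_automaton"
  assumes n: "n \<ge> 4"
    and M: "alphabet M = gens (n - 1)" "recognizes M (mirror (rotating_words (n - 1)))"
    and P: "palphabet P = gens (n - 1)"
      "partial_recognizes P (mirror (rotating_words_star (n - 1)))"
  shows "z \<in> lists (gens (n - 1)) \<Longrightarrow> run (trans M) (Some (init M)) z = Some s \<Longrightarrow>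
    v \<in> lists (gens n) \<Longrightarrow>
    run (trans (extend_automaton n M (next_partial n P))) (Some (Inl s)) v \<noteq> None \<longleftrightarrow>
    (\<exists>y us. rev (z @ y) \<in> rotating_words (n - 1) \<and> v = y @ map (phi n) (rev (block_word n us)) \<and>
      (us = [] \<or> chain n us \<or> skip_chain n us))"
proof (induction v arbitrary: z s)
  case Nil
  have "rev z \<in> rotating_words (n - 1)"
    using M Nil unfolding rev_in_mirror recognizes_def by auto
  then show ?case by (auto intro!: exI[of _ "[]"])
next
  case (Cons x v)
  let ?N = "extend_automaton n M (next_partial n P)"
  have x: "x \<in> gens n" "v \<in> lists (gens n)" using Cons.prems(3) by auto
  have rot: "rev u \<in> rotating_words (n - 1) \<longleftrightarrow>
      u \<in> lists (gens (n - 1)) \<and> run (trans M) (Some (init M)) u \<noteq> None" for u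
    using M unfolding rev_in_mirror recognizes_def by auto
  \<comment> \<open>The second nonempty block opens with index \<open>n\<close>, whether or not an
    empty block precedes it; this makes the end of the first block unambiguous.\<close>
  have first: "x \<notin> gens (n - 1)"
    if us: "us = [] \<or> chain n us \<or> skip_chain n us" "x # v = map (phi n) (rev (block_word n us))" for us
  proof -
    have letter: "phi n (last (hd us')) = (Suc (fst (last (hd us'))), n)"
      "\<exists>w. rev (block_word n us') = last (hd us') # w" if "chain n us'" for us'
      using that phi_last_chain_block[OF _ that] n by (auto elim: chain_first_letter)
    consider "chain n us" | us' where "us = [] # us'" "chain n us'" "last (hd us') = (n - 2, n - 1)"
      using us by (auto simp: skip_chain_def)
    then have "snd x = n"
    proof cases
      case 1
      then show ?thesis using letter[OF 1] us(2) by (auto simp del: phi.simps)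
    next
      case 2
      have "phi n (phi n (last (hd us'))) = (1, n)" using 2(3) n by simp
      then show ?thesis
        using letter(2)[OF 2(2)] us(2) unfolding 2(1) rev_block_word by (auto simp del: phi.simps)
    qed
    then show ?thesis using n by (auto simp: gens_def)
  qed
  show ?case
  proof (cases "x \<in> gens (n - 1)")
    case True
    have ex: "(\<exists>y us. rev (z @ y) \<in> rotating_words (n - 1) \<and> x # v = y @ map (phi n) (rev (block_word n us)) \<and>
        (us = [] \<or> chain n us \<or> skip_chain n us)) \<longleftrightarrow>
      (\<exists>y us. rev ((z @ [x]) @ y) \<in> rotating_words (n - 1) \<and> v = y @ map (phi n) (rev (block_word n us)) \<and>
        (us = [] \<or> chain n us \<or> skip_chain n us))" (is "?L \<longleftrightarrow> ?R")
    proof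
      assume ?L
      then obtain y us where y: "rev (z @ y) \<in> rotating_words (n - 1)"
        "x # v = y @ map (phi n) (rev (block_word n us))" "us = [] \<or> chain n us \<or> skip_chain n us"
        by (elim exE conjE)
      then obtain y' where "y = x # y'" using first[OF y(3)] True by (cases y) auto
      then show ?R using y by (intro exI[of _ y'] exI[of _ us]) simp
    next
      assume ?R
      then obtain y us where y: "rev ((z @ [x]) @ y) \<in> rotating_words (n - 1)"
        "v = y @ map (phi n) (rev (block_word n us))" "us = [] \<or> chain n us \<or> skip_chain n us"
        by (elim exE conjE)
      then show ?L by (intro exI[of _ "x # y"] exI[of _ us]) simp
    qed
    have step: "trans ?N (Inl s) x = map_option Inl (trans M s x)"
      using True by (simp add: extend_automaton_def)
    have snoc: "run (trans M) (Some (init M)) (z @ [x]) = trans M s x"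
      using Cons.prems(2) by (simp add: run_append)
    show ?thesis
    proof (cases "trans M s x")
      case None
      then have "rev ((z @ [x]) @ y) \<notin> rotating_words (n - 1)" for y
        unfolding rot run_append[of _ _ "z @ [x]"] snoc by simp
      then show ?thesis unfolding ex using None step by simp
    next
      case (Some s')
      have "z @ [x] \<in> lists (gens (n - 1))" using Cons.prems(1) True by simp
      from Cons.IH[OF this _ x(2), of s'] show ?thesis
        unfolding ex using Some step snoc by simp
    qed
  next
    case False
    have "rev z \<in> rotating_words (n - 1)" using rot Cons.prems by simp
    have ex: "(\<exists>y us. rev (z @ y) \<in> rotating_words (n - 1) \<and> x # v = y @ map (phi n) (rev (block_word n us)) \<and>
        (us = [] \<or> chain n us \<or> skip_chain n us)) \<longleftrightarrow>
      (\<exists>us. (chain n us \<or> skip_chain n us) \<and> x # v = map (phi n) (rev (block_word n us)))" (is "?L \<longleftrightarrow> ?R")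
    proof
      assume ?L
      then obtain y us where y: "rev (z @ y) \<in> rotating_words (n - 1)"
        "x # v = y @ map (phi n) (rev (block_word n us))" "us = [] \<or> chain n us \<or> skip_chain n us"
        by (elim exE conjE)
      have "y = []"
        using y(1,2) False unfolding rot by (cases y) auto
      moreover from this have "us \<noteq> []" using y(2) by auto
      ultimately show ?R using y(2,3) by (intro exI[of _ us]) simp
    next
      assume ?R
      then obtain us where "chain n us \<or> skip_chain n us" "x # v = map (phi n) (rev (block_word n us))"
        by (elim exE conjE)
      then show ?L
        using \<open>rev z \<in> rotating_words (n - 1)\<close> by (intro exI[of _ "[]"] exI[of _ us]) simp
    qed
    have "trans ?N (Inl s) x = map_option Inr (next_init n P x)"
      using False by (simp add: extend_automaton_def next_partial_def)
    then have "run (trans ?N) (Some (Inl s)) (x # v) =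
        map_option Inr (run (next_trans n P) (next_init n P x) v)"
      using run_extend_Inr[of n M "next_partial n P" "next_init n P x" v]
      by (simp add: next_partial_def)
    then show ?thesis
      unfolding ex using run_next_init[OF n P x(2,1) False] by simp
  qed
qed

theorem proposition5p8:
  fixes n :: nat
    and M :: "('s, letter) automaton"
    and P :: "('t, letter) partial_automaton"
  assumes "n \<ge> 4"
    and "is_automaton M" and "alphabet M = gens (n - 1)"
    and "is_partial_automaton P" and "palphabet P = gens (n - 1)"
    and "partial_recognizes P (mirror (rotating_words_star (n - 1)))"
    and "recognizes M (mirror (rotating_words (n - 1)))"
  shows "is_automaton (extend_automaton n M (next_partial n P)) \<and>
    recognizes (extend_automaton n M (next_partial n P)) (mirror (rotating_words n))"
proof
  let ?N = "extend_automaton n M (next_partial n P)"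
  show "is_automaton ?N"
    using assms by (intro is_automaton_extend is_partial_automaton_next) (auto simp: next_partial_def)
  have "v \<in> mirror (rotating_words n) \<longleftrightarrow>
      run (trans ?N) (Some (Inl (init M))) v \<noteq> None" if v: "v \<in> lists (gens n)" for v
  proof -
    have eq: "rev v = block_word n (rev y # us) \<longleftrightarrow> v = y @ map (phi n) (rev (block_word n us))" for y us
      using rev_block_word[of n "rev y" us] by (metis rev_rev_ident)
    have "v \<in> mirror (rotating_words n) \<longleftrightarrow>
        (\<exists>u us. rev v = block_word n (u # us) \<and> u \<in> rotating_words (n - 1) \<and>
          (us = [] \<or> chain n us \<or> skip_chain n us))"
      unfolding rev_in_mirror[symmetric] rotating_words_iff_chain[OF assms(1)] ..
    also have "\<dots> \<longleftrightarrow> (\<exists>y us. rev v = block_word n (rev y # us) \<and> rev y \<in> rotating_words (n - 1) \<and>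
          (us = [] \<or> chain n us \<or> skip_chain n us))"
      by (metis rev_rev_ident)
    also have "\<dots> \<longleftrightarrow> run (trans ?N) (Some (Inl (init M))) v \<noteq> None"
      using run_extend_Inl[OF assms(1,3,7,5,6), of "[]" "init M" v] v unfolding eq by auto
    finally show ?thesis .
  qed
  moreover have "v \<in> lists (gens n)" if "v \<in> mirror (rotating_words n)" for v
    using that rotating_words_lists[of "rev v" n] unfolding rev_in_mirror[symmetric]
    by (simp add: in_lists_conv_set)
  moreover have "alphabet ?N = gens n" "init ?N = Inl (init M)"
    by (simp_all add: extend_automaton_def)
  ultimately show "recognizes ?N (mirror (rotating_words n))"
    unfolding recognizes_def by auto
qed

end
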